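(* Let $n\ge2$, $c>0$, and let $p,q\in\mathbb{R}^n$ with $p\ne q$. Let $\Lambda=(\Lambda^\mu_{\ \nu})_{0\le\mu,\nu\le n}$ be any Lorentz transformation with $\Lambda^\mu_{\ \nu}(p^\nu+q^\nu)=(\sqrt{s},0,\ldots,0)$. Then for any suitable integrable function $G:\mathbb{R}^n\times\mathbb{R}^n\times\mathbb{R}^n\times\mathbb{R}^n\to\mathbb{R}$, $$\int_{\mathbb{S}^{n-1}}d\omega\;v_M(p,q)\,\sigma(\varrho,\theta)\,G(p,q,p',q')=\int_{\mathbb{S}^{n-1}}d\omega\;\frac{s\,\sigma(\varrho,\theta)}{p^0q^0}\,B_n(p,q,\omega)\,G(p,q,p',q').$$ Here $v_M(p,q)=\frac{c}{4}\frac{\varrho\sqrt{s}}{p^0q^0}$. On the left-hand side, with $k^i=\Lambda^i_{\ \mu}(p^\mu-q^\mu)$ and $L^{\mu\kappa}=-g^{\mu\lambda}\Lambda^\kappa_{\ \lambda}$, the angle and post-collisional momenta are given by $$\cos\theta=\frac{k}{|k|}\cdot\omega,\qquad p'^i=L^{i0}\frac{\sqrt s}{2}-L^{ij}\omega_j\frac{\varrho}{2},\qquad q'^i=L^{i0}\frac{\sqrt s}{2}+L^{ij}\omega_j\frac{\varrho}{2}\qquad(i=1,\ldots,n).$$ On the right-hand side they are given by $$\cos\theta=1-\frac{8}{\varrho^2}\frac{\{\omega\cdot(p^0q-q^0p)\}^2}{(p^0+q^0)^2-(\omega\cdot[p+q])^2},\qquad p'=p+a\,\omega,\qquad q'=q-a\,\omega,\qquad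 a=\frac{2(p^0+q^0)\{\omega\cdot(p^0q-q^0p)\}}{(p^0+q^0)^2-(\omega\cdot[p+q])^2},$$ and $B_n(p,q,\omega)=B(p,q,\omega)\,(A(p,q,\omega))^{n-3}$ with $$B=c\,\frac{(p^0+q^0)^2p^0q^0\left|\omega\cdot\left(\frac{p}{p^0}-\frac{q}{q^0}\right)\right|}{\left[(p^0+q^0)^2-(\omega\cdot[p+q])^2\right]^2},\qquad A=\frac{(p^0+q^0)p^0q^0\left|\omega\cdot\left(\frac{p}{p^0}-\frac{q}{q^0}\right)\right|}{(p^0+q^0)^2-(\omega\cdot[p+q])^2}\,\frac{4}{\varrho}.$$
   Context: Notation. For a momentum $p\in\mathbb{R}^n$ the energy is $p^0=\sqrt{c^2+|p|^2}$ and $p^\mu=(p^0,p)$; similarly for $q$. Greek indices run over $0,\ldots,n$, Latin indices over $1,\ldots,n$; repeated indices are summed. The Minkowski metric is $(g_{\mu\nu})=\mathrm{diag}(-1,1,\ldots,1)$ with inverse $g^{\mu\nu}$, and $\omega_j=\omega^j$. Set $$\varrho=\sqrt{2(p^0q^0-p\cdot q-c^2)},\qquad s=2(p^0q^0-p\cdot q+c^2).$$ A real matrix $\Lambda=(\Lambda^\mu_{\ \nu})$ of size $(1+n)\times(1+n)$ is a (proper) Lorentz transformation if $\det\Lambda=1$ and $\Lambda^\kappa_{\ \mu}g_{\kappa\lambda}\Lambda^\lambda_{\ \nu}=g_{\mu\nu}$ for all $\mu,\nu$. $\sigma(\varrho,\theta)$ is a given function (the differential cross-section), $\theta\in[0,\pi]$.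 "Suitable integrable" means that $\sigma$ and $G$ are measurable and such that the integrals converge absolutely. $d\omega$ is the surface measure on the unit sphere $\mathbb{S}^{n-1}$. When $n=2$, $B_n$ is understood for almost every $\omega$ (those with $A\neq0$). *)

theory Defs
  imports "HOL-Analysis.Analysis"
begin

text \<open>Space-time indices \<open>0, \<dots>, n\<close> are the elements of \<open>'n option\<close>: \<open>None\<close> is the time
  index \<open>0\<close> and \<open>Some i\<close> the spatial index \<open>i\<close>. A matrix entry \<open>M $ \<mu> $ \<nu>\<close> of a Lorentz
  transformation is the component with upper index \<open>\<mu>\<close> and lower index \<open>\<nu>\<close>.\<close>

type_synonym 'n spacetime = "real ^ 'n option"
type_synonym 'n spacetime_matrix = "real ^ 'n option ^ 'n option"

definition energy :: "real \<Rightarrow> real ^ 'n \<Rightarrow> real" where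
  "energy c p = sqrt (c\<^sup>2 + (norm p)\<^sup>2)"

definition spacetime_vec :: "real \<Rightarrow> real ^ 'n \<Rightarrow> 'n::finite spacetime" where
  "spacetime_vec t x = (\<chi> \<mu>. case \<mu> of None \<Rightarrow> t | Some i \<Rightarrow> x $ i)"

definition four_mom :: "real \<Rightarrow> real ^ 'n \<Rightarrow> 'n::finite spacetime" where
  "four_mom c p = spacetime_vec (energy c p) p"

definition minkowski :: "'n::finite spacetime_matrix" where
  "minkowski = (\<chi> \<mu> \<nu>. if \<mu> = \<nu> then (case \<mu> of None \<Rightarrow> - 1 | Some i \<Rightarrow> 1) else 0)"

definition lorentz :: "'n::finite spacetime_matrix \<Rightarrow> bool" where
  "lorentz \<Lambda> \<longleftrightarrow> det \<Lambda> = 1 \<and>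
     (\<forall>\<mu> \<nu>. (\<Sum>\<kappa>\<in>UNIV. \<Sum>\<rho>\<in>UNIV. \<Lambda> $ \<kappa> $ \<mu> * minkowski $ \<kappa> $ \<rho> * \<Lambda> $ \<rho> $ \<nu>) = minkowski $ \<mu> $ \<nu>)"

definition rel_mom :: "real \<Rightarrow> real ^ 'n \<Rightarrow> real ^ 'n \<Rightarrow> real" where
  "rel_mom c p q = sqrt (2 * (energy c p * energy c q - p \<bullet> q - c\<^sup>2))"

definition mandelstam_s :: "real \<Rightarrow> real ^ 'n \<Rightarrow> real ^ 'n \<Rightarrow> real" where
  "mandelstam_s c p q = 2 * (energy c p * energy c q - p \<bullet> q + c\<^sup>2)"

definition moller_velocity :: "real \<Rightarrow> real ^ 'n \<Rightarrow> real ^ 'n \<Rightarrow> real" where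
  "moller_velocity c p q =
     c / 4 * (rel_mom c p q * sqrt (mandelstam_s c p q) / (energy c p * energy c q))"

text \<open>Surface measure on the unit sphere of a Euclidean space of dimension \<open>d\<close>: the measure of
  \<open>A\<close> is \<open>d\<close> times the Lebesgue measure of the cone \<open>{r x | 0 < r < 1, x \<in> A}\<close>
  (see \<open>emeasure_sphere_measure\<close>). It lives on the Borel subsets of the sphere.\<close>

definition sphere_measure :: "'a::euclidean_space measure" where
  "sphere_measure =
     scale_measure (ennreal (real DIM('a)))
       (distr (restrict_space lborel (ball 0 1 - {0})) (restrict_space borel (sphere 0 1)) sgn)"

lemma space_sphere_measure [simp]: "space sphere_measure = sphere 0 1"
  by (simp add: sphere_measure_def space_restrict_space space_scale_measure)

lemma sets_sphere_measure [measurable_cong]: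
  "sets sphere_measure = sets (restrict_space borel (sphere 0 1))"
  by (simp add: sphere_measure_def)

lemma measurable_sgn_sphere:
  "(sgn :: 'a::euclidean_space \<Rightarrow> 'a) \<in>
     restrict_space lborel (ball 0 1 - {0}) \<rightarrow>\<^sub>M restrict_space borel (sphere 0 1)"
proof (rule measurable_restrict_space2)
  show "(sgn :: 'a \<Rightarrow> 'a) \<in> space (restrict_space lborel (ball 0 1 - {0})) \<rightarrow> sphere 0 1"
    by (auto simp: space_restrict_space norm_sgn)
  have "(sgn :: 'a \<Rightarrow> 'a) \<in> borel_measurable borel"
    unfolding sgn_div_norm by measurable
  then show "(sgn :: 'a \<Rightarrow> 'a) \<in> borel_measurable (restrict_space lborel (ball 0 1 - {0}))"
    by (intro measurable_restrict_space1) simp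
qed

lemma emeasure_sphere_measure:
  fixes A :: "'a::euclidean_space set"
  assumes "A \<in> sets borel" "A \<subseteq> sphere 0 1"
  shows "emeasure sphere_measure A =
    ennreal (real DIM('a)) * emeasure lborel {r *\<^sub>R x | r x. 0 < r \<and> r < 1 \<and> x \<in> A}"
proof -
  let ?S = "ball 0 1 - {0} :: 'a set"
  have A: "A \<in> sets (restrict_space borel (sphere 0 1))"
    using assms by (auto simp: sets_restrict_space)
  have S: "?S \<in> sets borel" by simp
  have cone: "sgn -` A \<inter> ?S = {r *\<^sub>R x | r x. 0 < r \<and> r < 1 \<and> x \<in> A}"
  proof (intro equalityI subsetI)
    fix y assume y: "y \<in> sgn -` A \<inter> ?S"
    then have "y = norm y *\<^sub>R sgn y" by (simp add: sgn_div_norm)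
    with y show "y \<in> {r *\<^sub>R x | r x. 0 < r \<and> r < 1 \<and> x \<in> A}"
      by (intro CollectI exI[of _ "norm y"] exI[of _ "sgn y"]) auto
  next
    fix y assume "y \<in> {r *\<^sub>R x | r x. 0 < r \<and> r < 1 \<and> x \<in> A}"
    then obtain r x where "y = r *\<^sub>R x" "0 < r" "r < 1" "x \<in> A" by auto
    moreover from this assms have "norm x = 1" by auto
    ultimately show "y \<in> sgn -` A \<inter> ?S" by (auto simp: sgn_div_norm)
  qed
  have "emeasure sphere_measure A =
      ennreal (real DIM('a)) * emeasure (restrict_space lborel ?S) (sgn -` A \<inter> ?S)"
    unfolding sphere_measure_def
    by (simp add: emeasure_distr[OF measurable_sgn_sphere A] space_restrict_space)
  also have "emeasure (restrict_space lborel ?S) (sgn -` A \<inter> ?S) = emeasure lborel (sgn -` A \<inter> ?S)"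
    by (rule emeasure_restrict_space) auto
  finally show ?thesis by (simp only: cone)
qed

text \<open>The prefixes \<open>cm_\<close> and \<open>gs_\<close> refer to the centre-of-momentum parametrization (through
  \<open>\<Lambda>\<close>) and to the Glassey--Strauss parametrization. In both, the scattering angle in \<open>[0, \<pi>]\<close>
  is given by its cosine, hence \<open>arccos\<close>.\<close>

definition cm_k :: "real \<Rightarrow> 'n::finite spacetime_matrix \<Rightarrow> real ^ 'n \<Rightarrow> real ^ 'n \<Rightarrow> real ^ 'n" where
  "cm_k c \<Lambda> p q = (\<chi> i. \<Sum>\<mu>\<in>UNIV. \<Lambda> $ Some i $ \<mu> * (four_mom c p - four_mom c q) $ \<mu>)"

definition cm_L :: "'n::finite spacetime_matrix \<Rightarrow> 'n spacetime_matrix" where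
  "cm_L \<Lambda> = (\<chi> \<mu> \<kappa>. - (\<Sum>\<rho>\<in>UNIV. matrix_inv minkowski $ \<mu> $ \<rho> * \<Lambda> $ \<kappa> $ \<rho>))"

definition cm_theta ::
  "real \<Rightarrow> 'n::finite spacetime_matrix \<Rightarrow> real ^ 'n \<Rightarrow> real ^ 'n \<Rightarrow> real ^ 'n \<Rightarrow> real" where
  "cm_theta c \<Lambda> p q \<omega> = arccos ((cm_k c \<Lambda> p q /\<^sub>R norm (cm_k c \<Lambda> p q)) \<bullet> \<omega>)"

definition cm_p' ::
  "real \<Rightarrow> 'n::finite spacetime_matrix \<Rightarrow> real ^ 'n \<Rightarrow> real ^ 'n \<Rightarrow> real ^ 'n \<Rightarrow> real ^ 'n" where
  "cm_p' c \<Lambda> p q \<omega> = (\<chi> i. cm_L \<Lambda> $ Some i $ None * (sqrt (mandelstam_s c p q) / 2)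
      - (\<Sum>j\<in>UNIV. cm_L \<Lambda> $ Some i $ Some j * \<omega> $ j) * (rel_mom c p q / 2))"

definition cm_q' ::
  "real \<Rightarrow> 'n::finite spacetime_matrix \<Rightarrow> real ^ 'n \<Rightarrow> real ^ 'n \<Rightarrow> real ^ 'n \<Rightarrow> real ^ 'n" where
  "cm_q' c \<Lambda> p q \<omega> = (\<chi> i. cm_L \<Lambda> $ Some i $ None * (sqrt (mandelstam_s c p q) / 2)
      + (\<Sum>j\<in>UNIV. cm_L \<Lambda> $ Some i $ Some j * \<omega> $ j) * (rel_mom c p q / 2))"

definition gs_denom :: "real \<Rightarrow> real ^ 'n \<Rightarrow> real ^ 'n \<Rightarrow> real ^ 'n \<Rightarrow> real" where
  "gs_denom c p q \<omega> = (energy c p + energy c q)\<^sup>2 - (\<omega> \<bullet> (p + q))\<^sup>2"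

definition gs_a :: "real \<Rightarrow> real ^ 'n \<Rightarrow> real ^ 'n \<Rightarrow> real ^ 'n \<Rightarrow> real" where
  "gs_a c p q \<omega> =
     2 * (energy c p + energy c q) * (\<omega> \<bullet> (energy c p *\<^sub>R q - energy c q *\<^sub>R p)) / gs_denom c p q \<omega>"

definition gs_theta :: "real \<Rightarrow> real ^ 'n \<Rightarrow> real ^ 'n \<Rightarrow> real ^ 'n \<Rightarrow> real" where
  "gs_theta c p q \<omega> = arccos (1 - 8 / (rel_mom c p q)\<^sup>2 *
     ((\<omega> \<bullet> (energy c p *\<^sub>R q - energy c q *\<^sub>R p))\<^sup>2 / gs_denom c p q \<omega>))"

definition gs_p' :: "real \<Rightarrow> real ^ 'n \<Rightarrow> real ^ 'n \<Rightarrow> real ^ 'n \<Rightarrow> real ^ 'n" where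
  "gs_p' c p q \<omega> = p + gs_a c p q \<omega> *\<^sub>R \<omega>"

definition gs_q' :: "real \<Rightarrow> real ^ 'n \<Rightarrow> real ^ 'n \<Rightarrow> real ^ 'n \<Rightarrow> real ^ 'n" where
  "gs_q' c p q \<omega> = q - gs_a c p q \<omega> *\<^sub>R \<omega>"

definition gs_B :: "real \<Rightarrow> real ^ 'n \<Rightarrow> real ^ 'n \<Rightarrow> real ^ 'n \<Rightarrow> real" where
  "gs_B c p q \<omega> =
     c * ((energy c p + energy c q)\<^sup>2 * energy c p * energy c q
          * \<bar>\<omega> \<bullet> (p /\<^sub>R energy c p - q /\<^sub>R energy c q)\<bar> / (gs_denom c p q \<omega>)\<^sup>2)"

definition gs_A :: "real \<Rightarrow> real ^ 'n \<Rightarrow> real ^ 'n \<Rightarrow> real ^ 'n \<Rightarrow> real" where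
  "gs_A c p q \<omega> =
     (energy c p + energy c q) * energy c p * energy c q
       * \<bar>\<omega> \<bullet> (p /\<^sub>R energy c p - q /\<^sub>R energy c q)\<bar> / gs_denom c p q \<omega> * (4 / rel_mom c p q)"

text \<open>The exponent \<open>n - 3\<close> is an integer power. For \<open>n = 2\<close> the formula is meaningful only where
  \<open>gs_A\<close> is nonzero, that is for almost every \<open>\<omega>\<close>; on the exceptional null set it evaluates
  to \<open>0\<close>.\<close>

definition gs_Bn :: "real \<Rightarrow> real ^ 'n \<Rightarrow> real ^ 'n \<Rightarrow> real ^ 'n \<Rightarrow> real" where
  "gs_Bn c p q \<omega> = gs_B c p q \<omega> * (gs_A c p q \<omega>) powi (int CARD('n) - 3)"

end

theory Submission
  imports Defs
begin

text \<open>
  The two parametrizations describe the same set of outgoing momenta: the unit vector of the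
  centre-of-momentum frame that belongs to a unit vector \<open>\<omega>\<close> of the laboratory frame is an explicit
  function \<open>T \<omega>\<close>, and the theorem says that \<open>T\<close> carries the measure with density proportional to
  \<open>B\<^sub>n\<close> to the surface measure.

  To find \<open>T\<close>, note that in the laboratory frame \<open>p' - p\<close> is a multiple of \<open>\<omega>\<close>. The four-vector
  \<open>p'\<^sup>\<mu> - p\<^sup>\<mu>\<close> is orthogonal to the total momentum, because in the centre-of-momentum frame the
  energies do not change. Hence it is a multiple of the four-vector \<open>lift \<omega>\<close> with spatial part
  \<open>\<omega>\<close> and the time component that makes it orthogonal to the total momentum. \<open>\<Lambda>\<close> maps
  \<open>lift \<omega>\<close> to \<open>(0, N \<omega>)\<close> with a linear map \<open>N\<close> of space. If \<open>k\<close> is the relative momentum in the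
  centre-of-momentum frame, the outgoing direction differs from \<open>k / |k|\<close> by a multiple of \<open>N \<omega>\<close>,
  and since both are unit vectors, \<open>T \<omega>\<close> is the mirror image of \<open>k / |k|\<close> in the hyperplane
  orthogonal to \<open>N \<omega>\<close>. All identities between the kinematic quantities follow from
  the invariance of the Minkowski product; this is the content of \<open>collision.lorentz_outgoing\<close>,
  \<open>collision.cm_theta_T\<close> and \<open>collision.weight_eq\<close>.

  The Jacobian of \<open>T\<close> on the sphere comes from a Jacobian in \<open>\<real>\<^sup>n\<close>. With \<open>\<kappa> = k / |k|\<close>, the quadratic
  map \<open>z \<mapsto> |z|\<^sup>2 \<kappa> - 2 (\<kappa> \<bullet> z) z\<close> has the mirror image of \<open>\<kappa>\<close> as its direction, and its derivative
  is \<open>- 2 (\<kappa> \<bullet> z)\<close> times the identity plus a skew operator of rank two, so its determinant is explicit.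
  A homogeneous map of \<open>\<real>\<^sup>n\<close> induces a change of variables on the sphere by polar coordinates
  (\<open>emeasure_sphere_homogeneous_map\<close>). Composed with \<open>N\<close>, the map is injective on the half-space
  \<open>\<kappa> \<bullet> N x > 0\<close> and omits only a subset of a line. It is even, so the opposite half-space
  gives the same result, and the mean of both is
  \<open>sphere_measure_eq_distr_reflection\<close>. The determinant of \<open>N\<close> needs no knowledge of the entries of
  \<open>\<Lambda>\<close>, since \<open>|N x|\<^sup>2 = |x|\<^sup>2 - (b \<bullet> x)\<^sup>2\<close> with \<open>b = (p + q) / (p\<^sup>0 + q\<^sup>0)\<close>.
\<close>

section \<open>Polar coordinates\<close>

lemma nn_integral_lborel_scaleR:
  fixes f :: "'a::euclidean_space \<Rightarrow> ennreal"
  assumes [measurable]: "f \<in> borel_measurable borel" and "c > 0"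
  shows "(\<integral>\<^sup>+x. f x \<partial>lborel) = ennreal (c ^ DIM('a)) * (\<integral>\<^sup>+x. f (c *\<^sub>R x) \<partial>lborel)"
  using \<open>c > 0\<close> by (subst lborel_affine[of c 0])
     (simp_all add: nn_integral_density nn_integral_distr nn_integral_cmult)

lemma linear_borel_measurable:
  fixes f :: "'a::euclidean_space \<Rightarrow> 'b::euclidean_space"
  assumes "linear f"
  shows "f \<in> borel_measurable borel"
  using assms by (intro borel_measurable_continuous_onI linear_continuous_on) (simp add: linear_conv_bounded_linear)

text \<open>Almost all functions below are Borel functions on the whole space; this rule restricts them to
  the sphere, so that measurability can be proved without mentioning the sphere.\<close>

lemma measurable_sphere_measureI:
  assumes "f \<in> borel \<rightarrow>\<^sub>M N"
  shows "f \<in> sphere_measure \<rightarrow>\<^sub>M N"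
  using measurable_restrict_space1[OF assms, of "sphere 0 1"]
  by (simp cong: measurable_cong_sets add: sets_sphere_measure)

lemma nn_integral_sphere_measure:
  fixes g :: "'a::euclidean_space \<Rightarrow> ennreal"
  assumes [measurable]: "g \<in> borel_measurable sphere_measure"
  shows "(\<integral>\<^sup>+u. g u \<partial>sphere_measure) =
    DIM('a) * (\<integral>\<^sup>+z. g (sgn z) * indicator (ball 0 1 - {0}) z \<partial>lborel)"
proof -
  have g: "g \<in> borel_measurable (restrict_space borel (sphere 0 1))"
    using assms by (simp cong: measurable_cong_sets add: sets_sphere_measure)
  show ?thesis
    unfolding sphere_measure_def
    by (subst nn_integral_scale_measure)
      (simp_all add: g nn_integral_distr measurable_sgn_sphere nn_integral_restrict_space
        ennreal_of_nat_eq_real_of_nat)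
qed

lemma nn_integral_inverse_power_tail:
  fixes a :: real
  assumes "a > 0" "m > 0"
  shows "(\<integral>\<^sup>+t. ennreal (inverse (t ^ Suc m)) * indicator {0<..} (t - a) \<partial>lborel) = ennreal (inverse (a ^ m) / m)"
proof -
  have "(\<integral>\<^sup>+t. ennreal (inverse (t ^ Suc m)) * indicator {0<..} (t - a) \<partial>lborel) =
     (\<integral>\<^sup>+t. ennreal (inverse (t ^ Suc m)) * indicator {a..} t \<partial>lborel)"
    by (rule nn_integral_cong_AE, use AE_lborel_singleton[of a] in eventually_elim)
      (auto simp: indicator_def)
  also have "\<dots> = ennreal (0 - (- inverse (a ^ m) / m))"
  proof (rule nn_integral_FTC_atLeast)
    fix x assume "a \<le> x"
    with assms show "((\<lambda>x. - inverse (x ^ m) / m) has_real_derivative inverse (x ^ Suc m)) (at x)"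
    proof -
      have "x > 0" "x ^ m * x ^ m > 0" "Suc (m - 1) = m"
        using assms \<open>a \<le> x\<close> by auto
      moreover from this have "x ^ m = x * x ^ (m - 1)"
        by (metis power_Suc)
      ultimately show ?thesis
        using assms(2) by (auto intro!: derivative_eq_intros)
    qed
    show "0 \<le> inverse (x ^ Suc m)" using assms \<open>a \<le> x\<close> by simp
  next
    have "((\<lambda>x::real. - inverse (x ^ m) / m) \<longlongrightarrow> - 0 / m) at_top"
      using assms by (intro tendsto_intros tendsto_inverse_0_at_top filterlim_pow_at_top filterlim_ident) auto
    then show "((\<lambda>x::real. - inverse (x ^ m) / m) \<longlongrightarrow> 0) at_top" by simp
  qed simp
  finally show ?thesis by simp
qed

text \<open>Polar coordinates follow from Fubini's theorem and the scaling of Lebesgue measure alone. By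
  the definition of the surface measure, the right-hand side is \<open>n\<close> times the integral over the unit ball of
  \<open>\<integral> F (r sgn z) r\<^sup>n\<^sup>-\<^sup>1 dr\<close>. Substituting \<open>r = t |z|\<close>, exchanging the
  integrals and substituting \<open>y = t z\<close> turns it into \<open>n \<integral> F(y) |y|\<^sup>n \<integral> t\<^sup>-\<^sup>n\<^sup>-\<^sup>1 dt dy\<close>, where
  the inner integral extends over \<open>t > |y|\<close> and is \<open>|y|\<^sup>-\<^sup>n / n\<close>.\<close>

lemma nn_integral_polar:
  fixes F :: "'a::euclidean_space \<Rightarrow> ennreal"
  assumes [measurable]: "F \<in> borel_measurable borel"
  shows "(\<integral>\<^sup>+x. F x \<partial>lborel) =
    (\<integral>\<^sup>+u. (\<integral>\<^sup>+r. F (r *\<^sub>R u) * ennreal (r ^ (DIM('a) - 1)) * indicator {0<..} r \<partial>lborel) \<partial>sphere_measure)"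
proof -
  let ?n = "DIM('a)"
  have pow_n: "x ^ ?n = x * x ^ (?n - 1)" for x :: real
    by (simp add: power_Suc[symmetric] del: power_Suc)
  define R where "R u = (\<integral>\<^sup>+r. F (r *\<^sub>R u) * ennreal (r ^ (?n - 1)) * indicator {0<..} r \<partial>lborel)" for u
  have R_borel [measurable]: "R \<in> borel_measurable borel"
    unfolding R_def by measurable
  have R_sphere [measurable]: "R \<in> borel_measurable sphere_measure"
    using measurable_restrict_space1[OF R_borel, of "sphere 0 1"]
    by (simp cong: measurable_cong_sets add: sets_sphere_measure)
  define B C :: "'a set" where "B = ball 0 1 - {0}" and "C = -{0}"
  have [measurable]: "B \<in> sets borel" "C \<in> sets borel"
    by (simp_all add: B_def C_def)
  have R_sgn: "R (sgn z) = (\<integral>\<^sup>+t. F (t *\<^sub>R z) * ennreal (t ^ (?n - 1) * norm z ^ ?n) * indicator {0<..} t \<partial>lborel)"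
    if "z \<noteq> 0" for z
  proof -
    have "R (sgn z) = ennreal (norm z) * (\<integral>\<^sup>+t. F ((norm z * t) *\<^sub>R sgn z) *
       ennreal ((norm z * t) ^ (?n - 1)) * indicator {0<..} (norm z * t) \<partial>lborel)"
      unfolding R_def by (subst nn_integral_real_affine[where c="norm z" and t=0]) (use that in auto)
    also have "\<dots> = (\<integral>\<^sup>+t. ennreal (norm z) * (F ((norm z * t) *\<^sub>R sgn z) *
       ennreal ((norm z * t) ^ (?n - 1)) * indicator {0<..} (norm z * t)) \<partial>lborel)"
      by (rule nn_integral_cmult[symmetric]) measurable
    also have "\<dots> = (\<integral>\<^sup>+t. F (t *\<^sub>R z) * ennreal (t ^ (?n - 1) * norm z ^ ?n) * indicator {0<..} t \<partial>lborel)"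
    proof (rule nn_integral_cong)
      fix t :: real
      have v: "(norm z * t) *\<^sub>R sgn z = t *\<^sub>R z"
        using that by (simp add: sgn_div_norm)
      have e: "ennreal (t ^ (?n - 1) * norm z ^ ?n) = ennreal (norm z) * ennreal ((norm z * t) ^ (?n - 1))" if "t > 0"
        using that by (simp add: ennreal_mult[symmetric] power_mult_distrib mult_ac pow_n)
      show "ennreal (norm z) * (F ((norm z * t) *\<^sub>R sgn z) * ennreal ((norm z * t) ^ (?n - 1)) *
          indicator {0<..} (norm z * t)) = F (t *\<^sub>R z) * ennreal (t ^ (?n - 1) * norm z ^ ?n) * indicator {0<..} t"
        unfolding v using that e by (cases "t > 0") (auto simp: indicator_def zero_less_mult_iff mult_ac)
    qed
    finally show ?thesis .
  qed
  have "(\<integral>\<^sup>+u. R u \<partial>sphere_measure) = ?n * (\<integral>\<^sup>+z. R (sgn z) * indicator B z \<partial>lborel)"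
    unfolding B_def by (rule nn_integral_sphere_measure) measurable
  also have "(\<integral>\<^sup>+z. R (sgn z) * indicator B z \<partial>lborel) =
    (\<integral>\<^sup>+z. (\<integral>\<^sup>+t. F (t *\<^sub>R z) * ennreal (t ^ (?n - 1) * norm z ^ ?n) * indicator {0<..} t * indicator B z \<partial>lborel) \<partial>lborel)"
    by (rule nn_integral_cong, subst nn_integral_multc) (auto simp: R_sgn indicator_def B_def)
  also have "\<dots> = (\<integral>\<^sup>+t. (\<integral>\<^sup>+z. F (t *\<^sub>R z) * ennreal (t ^ (?n - 1) * norm z ^ ?n) * indicator {0<..} t * indicator B z \<partial>lborel) \<partial>lborel)"
    by (rule lborel_pair.Fubini') measurable
  also have "\<dots> = (\<integral>\<^sup>+t. (\<integral>\<^sup>+y. F y * ennreal (norm y ^ ?n) * (ennreal (inverse (t ^ Suc ?n)) * indicator {0<..} (t - norm y))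
       * indicator C y \<partial>lborel) \<partial>lborel)"
  proof (rule nn_integral_cong)
    fix t :: real
    show "(\<integral>\<^sup>+z. F (t *\<^sub>R z) * ennreal (t ^ (?n - 1) * norm z ^ ?n) * indicator {0<..} t * indicator B z \<partial>lborel) =
      (\<integral>\<^sup>+y. F y * ennreal (norm y ^ ?n) * (ennreal (inverse (t ^ Suc ?n)) * indicator {0<..} (t - norm y))
       * indicator C y \<partial>lborel)"
    proof (cases "t > 0")
      case False
      have "\<not> norm y < t" for y :: 'a
        using False norm_ge_zero[of y] by linarith
      with False show ?thesis by simp
    next
      case True
      have "(\<integral>\<^sup>+y. F y * ennreal (norm y ^ ?n) * (ennreal (inverse (t ^ Suc ?n)) * indicator {0<..} (t - norm y))
         * indicator C y \<partial>lborel) = ennreal (t ^ ?n) *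
        (\<integral>\<^sup>+z. F (t *\<^sub>R z) * ennreal (norm (t *\<^sub>R z) ^ ?n) * (ennreal (inverse (t ^ Suc ?n)) *
           indicator {0<..} (t - norm (t *\<^sub>R z))) * indicator C (t *\<^sub>R z) \<partial>lborel)"
        by (rule nn_integral_lborel_scaleR[OF _ True]) measurable
      also have "\<dots> = (\<integral>\<^sup>+z. ennreal (t ^ ?n) * (F (t *\<^sub>R z) * ennreal (norm (t *\<^sub>R z) ^ ?n) * (ennreal (inverse (t ^ Suc ?n)) *
           indicator {0<..} (t - norm (t *\<^sub>R z))) * indicator C (t *\<^sub>R z)) \<partial>lborel)"
        by (rule nn_integral_cmult[symmetric]) measurable
      also have "\<dots> = (\<integral>\<^sup>+z. F (t *\<^sub>R z) * ennreal (t ^ (?n - 1) * norm z ^ ?n) * indicator {0<..} t * indicator B z \<partial>lborel)"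
      proof (rule nn_integral_cong)
        fix z :: 'a
        have "t ^ (?n - 1) * norm z ^ ?n = t ^ ?n * (norm (t *\<^sub>R z) ^ ?n * inverse (t ^ Suc ?n))"
          using True pow_n[of t] by (simp add: power_mult_distrib field_simps)
        then have e: "ennreal (t ^ (?n - 1) * norm z ^ ?n) =
           ennreal (t ^ ?n) * (ennreal (norm (t *\<^sub>R z) ^ ?n) * ennreal (inverse (t ^ Suc ?n)))"
          using True by (simp add: ennreal_mult[symmetric])
        have i: "norm (t *\<^sub>R z) < t \<longleftrightarrow> norm z < 1"
          using True by simp
        show "ennreal (t ^ ?n) * (F (t *\<^sub>R z) * ennreal (norm (t *\<^sub>R z) ^ ?n) * (ennreal (inverse (t ^ Suc ?n)) *
           indicator {0<..} (t - norm (t *\<^sub>R z))) * indicator C (t *\<^sub>R z)) =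
          F (t *\<^sub>R z) * ennreal (t ^ (?n - 1) * norm z ^ ?n) * indicator {0<..} t * indicator B z"
          unfolding e using True i by (auto simp: indicator_def B_def C_def mult_ac)
      qed
      finally show ?thesis by simp
    qed
  qed
  also have "\<dots> = (\<integral>\<^sup>+y. (\<integral>\<^sup>+t. F y * ennreal (norm y ^ ?n) * (ennreal (inverse (t ^ Suc ?n)) * indicator {0<..} (t - norm y))
       * indicator C y \<partial>lborel) \<partial>lborel)"
    by (rule lborel_pair.Fubini'[symmetric]) measurable
  also have "\<dots> = (\<integral>\<^sup>+y. F y / ?n \<partial>lborel)"
  proof (rule nn_integral_cong_AE, use AE_lborel_singleton[of "0::'a"] in eventually_elim)
    fix y :: 'a assume y: "y \<noteq> 0"
    have "(\<integral>\<^sup>+t. F y * ennreal (norm y ^ ?n) * (ennreal (inverse (t ^ Suc ?n)) * indicator {0<..} (t - norm y))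
       * indicator C y \<partial>lborel) = F y * ennreal (norm y ^ ?n) * ennreal (inverse (norm y ^ ?n) / ?n)"
      using y nn_integral_inverse_power_tail[of "norm y" ?n] by (simp add: C_def nn_integral_cmult)
    also have "\<dots> = F y * ennreal (1 / ?n)"
      using y by (simp add: mult.assoc ennreal_mult[symmetric])
    also have "\<dots> = F y / ?n"
      by (simp add: divide_ennreal_def ennreal_of_nat_eq_real_of_nat inverse_ennreal inverse_eq_divide[symmetric])
    finally show "(\<integral>\<^sup>+t. F y * ennreal (norm y ^ ?n) * (ennreal (inverse (t ^ Suc ?n)) * indicator {0<..} (t - norm y))
       * indicator C y \<partial>lborel) = F y / ?n" .
  qed
  also have "?n * \<dots> = (\<integral>\<^sup>+y. F y \<partial>lborel)"
    by (subst nn_integral_divide) (auto simp: ennreal_times_divide mult.commute[of "of_nat ?n"] ennreal_mult_divide_eq)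
  finally show ?thesis by (simp add: R_def)
qed

section \<open>Changes of variables on the sphere induced by homogeneous maps\<close>

text \<open>The change-of-variables formula for the constant function \<open>1\<close>, in terms of the nonnegative
  integral. Finiteness of the image is what makes the Jacobian integrable.\<close>

lemma emeasure_differentiable_image:
  fixes f :: "real^'n::{finite,wellorder} \<Rightarrow> real^'n::_"
  assumes S: "S \<in> sets lebesgue"
    and deriv: "\<And>x. x \<in> S \<Longrightarrow> (f has_derivative f' x) (at x within S)"
    and inj: "inj_on f S"
    and fin: "f ` S \<in> lmeasurable"
  shows "emeasure lebesgue (f ` S) = (\<integral>\<^sup>+x. ennreal \<bar>det (matrix (f' x))\<bar> * indicator S x \<partial>lborel)"
proof -
  \<comment> \<open>The formula concerns vector-valued functions, so the constant lives in dimension one.\<close>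
  let ?one = "\<lambda>_. 1 :: real^1"
  have "?one absolutely_integrable_on f ` S"
    using fin by (rule absolutely_integrable_on_const)
  then have D: "(\<lambda>x. \<bar>det (matrix (f' x))\<bar> *\<^sub>R ?one (f x)) absolutely_integrable_on S"
      "integral S (\<lambda>x. \<bar>det (matrix (f' x))\<bar> *\<^sub>R ?one (f x)) = integral (f ` S) ?one"
    using has_absolute_integral_change_of_variables[OF S deriv inj, of ?one] by auto
  then have "((\<lambda>x. \<bar>det (matrix (f' x))\<bar> *\<^sub>R ?one (f x)) has_integral integral (f ` S) ?one) S"
    by (metis absolutely_integrable_on_def has_integral_integral)
  from has_integral_linear[OF this bounded_linear_vec_nth[of 1]]
  have "((\<lambda>x. \<bar>det (matrix (f' x))\<bar>) has_integral integral (f ` S) ?one $ 1) S"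
    by (simp add: o_def)
  moreover have "integral (f ` S) ?one $ 1 = measure lebesgue (f ` S)"
  proof -
    have "(?one has_integral integral (f ` S) ?one) (f ` S)"
      using fin by (simp add: integrable_integral integrable_on_const)
    from has_integral_linear[OF this bounded_linear_vec_nth[of 1]]
    have "((\<lambda>_. 1) has_integral integral (f ` S) ?one $ 1) (f ` S)"
      by (simp add: o_def)
    then show ?thesis
      using fin by (simp add: lmeasure_integral integral_unique)
  qed
  ultimately have "(\<integral>\<^sup>+x. ennreal \<bar>det (matrix (f' x))\<bar> * indicator S x \<partial>lborel) = ennreal (measure lebesgue (f ` S))"
    by (intro nn_integral_has_integral_lebesgue') auto
  with fin show ?thesis
    by (simp add: emeasure_eq_measure2)
qed

lemma nn_integral_power_Ioo:
  fixes b :: real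
  assumes "b \<ge> 0"
  shows "(\<integral>\<^sup>+r. ennreal (r ^ m) * (indicator {0<..} r * indicator {0<..} (b - r)) \<partial>lborel) = ennreal (b ^ Suc m / Suc m)"
proof -
  have "(\<integral>\<^sup>+r. ennreal (r ^ m) * (indicator {0<..} r * indicator {0<..} (b - r)) \<partial>lborel) =
     (\<integral>\<^sup>+r. ennreal (r ^ m) * indicator {0..b} r \<partial>lborel)"
    by (rule nn_integral_cong_AE,
        use AE_lborel_singleton[of 0] AE_lborel_singleton[of b] in eventually_elim)
      (auto simp: indicator_def)
  also have "\<dots> = ennreal (b ^ Suc m / Suc m - 0 ^ Suc m / Suc m)"
  proof (rule nn_integral_FTC_Icc)
    show "((\<lambda>x. x ^ Suc m / Suc m) has_real_derivative x ^ m) (at x)" for x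
      by (auto intro!: derivative_eq_intros simp del: power_Suc)
  qed (use assms in auto)
  finally show ?thesis by simp
qed

text \<open>The surface measure of \<open>A\<close> is \<open>n\<close> times the volume of the cone over \<open>A\<close> in the unit ball. Pull
  this cone back by \<open>\<Psi>\<close> and write the volume in polar coordinates: on the ray through \<open>u\<close> the condition
  \<open>|\<Psi> (r u)| < 1\<close> is \<open>r\<^sup>d |\<Psi> u| < 1\<close> and the Jacobian is \<open>r\<^sup>n\<^sup>(\<^sup>d\<^sup>-\<^sup>1\<^sup>) J u\<close>, so the radial integral is
  elementary. Only a null set may be missing from the image of the cone \<open>H\<close>.\<close>

lemma emeasure_sphere_homogeneous_map:
  fixes \<Psi> :: "real^'n::{finite,wellorder} \<Rightarrow> real^'n::_"
  assumes [measurable]: "H \<in> sets borel" "\<Psi> \<in> borel_measurable borel" "J \<in> borel_measurable borel"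
    and cone: "\<And>x r. x \<in> H \<Longrightarrow> r > 0 \<Longrightarrow> r *\<^sub>R x \<in> H"
    and deriv: "\<And>x. x \<in> H \<Longrightarrow> (\<Psi> has_derivative \<Psi>' x) (at x)"
    and jac: "\<And>x. x \<in> H \<Longrightarrow> \<bar>det (matrix (\<Psi>' x))\<bar> = J x"
    and inj: "inj_on \<Psi> H"
    and negl: "negligible (- \<Psi> ` H)"
    and nz: "\<And>x. x \<in> H \<Longrightarrow> \<Psi> x \<noteq> 0"
    and "d > 0"
    and hom: "\<And>x r. r > 0 \<Longrightarrow> \<Psi> (r *\<^sub>R x) = r ^ d *\<^sub>R \<Psi> x"
    and hom_jac: "\<And>x r. r > 0 \<Longrightarrow> J (r *\<^sub>R x) = r ^ (CARD('n) * (d - 1)) * J x"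
    and A: "A \<in> sets sphere_measure"
  shows "emeasure sphere_measure A =
    (\<integral>\<^sup>+u. ennreal (J u / (d * norm (\<Psi> u) ^ CARD('n))) * indicator H u * indicator A (sgn (\<Psi> u)) \<partial>sphere_measure)"
proof -
  let ?n = "CARD('n)"
  have pos_n: "?n > 0" by simp
  have A' [measurable]: "A \<in> sets borel" and A_sph: "A \<subseteq> sphere 0 1"
    using A by (auto simp: sets_sphere_measure sets_restrict_space_iff)
  have sgn_borel [measurable]: "(sgn :: real^'n::_ \<Rightarrow> _) \<in> borel_measurable borel"
    unfolding sgn_div_norm by measurable
  \<comment> \<open>The origin is excluded automatically: \<open>sgn 0 = 0\<close> is not on the sphere.\<close>
  define E where "E = {y \<in> ball 0 1. sgn y \<in> A}"
  have E_borel [measurable]: "E \<in> sets borel"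
  proof -
    have "E = (sgn -` A \<inter> space borel) \<inter> ball 0 1" by (auto simp: E_def)
    also have "\<dots> \<in> sets borel" by (intro sets.Int measurable_sets[OF sgn_borel]) auto
    finally show ?thesis .
  qed
  have E_nz: "y \<noteq> 0" if "y \<in> E" for y
    using that A_sph by (auto simp: E_def)
  define S where "S = H \<inter> \<Psi> -` E"
  have S_borel [measurable]: "S \<in> sets borel"
    using measurable_sets[OF assms(2) E_borel] by (auto simp: S_def)
  have E_lm: "E \<in> lmeasurable"
    by (rule fmeasurableI2[of "ball 0 1"]) (auto simp: E_def[symmetric], auto simp: E_def)
  have image_S: "\<Psi> ` S = E \<inter> \<Psi> ` H"
    by (auto simp: S_def)
  have negl_diff: "negligible (sym_diff E (\<Psi> ` S))"
    by (rule negligible_subset[OF negl]) (auto simp: image_S)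
  have im_lm: "\<Psi> ` S \<in> lmeasurable"
    using lmeasurable_negligible_symdiff[OF E_lm negl_diff] .
  have "emeasure lebesgue E = emeasure lebesgue (\<Psi> ` S)"
    using measure_negligible_symdiff[OF _ negl_diff] E_lm im_lm
    by (simp add: emeasure_eq_measure2)
  also have "\<dots> = (\<integral>\<^sup>+x. ennreal \<bar>det (matrix (\<Psi>' x))\<bar> * indicator S x \<partial>lborel)"
  proof (rule emeasure_differentiable_image)
    show "(\<Psi> has_derivative \<Psi>' x) (at x within S)" if "x \<in> S" for x
      using deriv that by (auto simp: S_def intro: has_derivative_at_withinI)
    show "inj_on \<Psi> S"
      by (rule inj_on_subset[OF inj]) (auto simp: S_def)
  qed (use im_lm in auto)
  also have "\<dots> = (\<integral>\<^sup>+x. ennreal (J x) * indicator S x \<partial>lborel)"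
    by (rule nn_integral_cong) (auto simp: indicator_def S_def jac)
  also have "\<dots> = (\<integral>\<^sup>+u. (\<integral>\<^sup>+r. ennreal (J (r *\<^sub>R u)) * indicator S (r *\<^sub>R u) * ennreal (r ^ (?n - 1)) *
      indicator {0<..} r \<partial>lborel) \<partial>sphere_measure)"
    by (subst nn_integral_polar) simp_all
  also have "\<dots> = (\<integral>\<^sup>+u. ennreal (J u / (d * norm (\<Psi> u) ^ ?n)) * indicator H u * indicator A (sgn (\<Psi> u)) / ?n \<partial>sphere_measure)"
  proof (rule nn_integral_cong)
    fix u :: "real^'n::_"
    show "(\<integral>\<^sup>+r. ennreal (J (r *\<^sub>R u)) * indicator S (r *\<^sub>R u) * ennreal (r ^ (?n - 1)) * indicator {0<..} r \<partial>lborel)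
      = ennreal (J u / (d * norm (\<Psi> u) ^ ?n)) * indicator H u * indicator A (sgn (\<Psi> u)) / ?n"
    proof (cases "u \<in> H \<and> sgn (\<Psi> u) \<in> A")
      case False
      have "r *\<^sub>R u \<notin> S" if "r > 0" for r
      proof
        assume "r *\<^sub>R u \<in> S"
        then have "u \<in> H" "sgn (\<Psi> u) \<in> A"
          using cone[of "r *\<^sub>R u" "inverse r"] that
          by (auto simp: S_def E_def hom sgn_scaleR)
        with False show False by blast
      qed
      then have "(\<integral>\<^sup>+r. ennreal (J (r *\<^sub>R u)) * indicator S (r *\<^sub>R u) * ennreal (r ^ (?n - 1)) * indicator {0<..} r \<partial>lborel)
        = (\<integral>\<^sup>+(r::real). 0 \<partial>lborel)"
        by (intro nn_integral_cong) (auto simp: indicator_def)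
      with False show ?thesis by auto
    next
      case True
      then have J: "J u \<ge> 0" and \<Psi>: "norm (\<Psi> u) > 0"
        using jac[of u] nz[of u] by auto
      \<comment> \<open>The ray through \<open>u\<close> meets the pulled-back cone exactly for \<open>0 < r < b\<close>.\<close>
      define b where "b = root d (1 / norm (\<Psi> u))"
      have b: "b > 0" "b ^ d = 1 / norm (\<Psi> u)"
        using \<open>d > 0\<close> \<Psi> by (auto simp: b_def)
      have S_iff: "r *\<^sub>R u \<in> S \<longleftrightarrow> r < b" if "r > 0" for r
      proof -
        have "r *\<^sub>R u \<in> S \<longleftrightarrow> r ^ d * norm (\<Psi> u) < 1"
          using True that cone[of u r] by (auto simp: S_def E_def hom sgn_scaleR)
        also have "\<dots> \<longleftrightarrow> r ^ d < b ^ d"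
          unfolding b(2) using \<Psi> by (simp add: field_simps)
        also have "\<dots> \<longleftrightarrow> r < b"
          using power_strict_mono[of r b d] power_less_imp_less_base[of r d b] that b(1) \<open>d > 0\<close> by fastforce
        finally show ?thesis .
      qed
      define m where "m = ?n * (d - 1) + (?n - 1)"
      have Suc_m: "Suc m = ?n * d"
        unfolding m_def using \<open>d > 0\<close> pos_n by (cases d; cases ?n) auto
      have "(\<integral>\<^sup>+r. ennreal (J (r *\<^sub>R u)) * indicator S (r *\<^sub>R u) * ennreal (r ^ (?n - 1)) * indicator {0<..} r \<partial>lborel)
        = (\<integral>\<^sup>+r. ennreal (J u) * (ennreal (r ^ m) *
            (indicator {0<..} r * indicator {0<..} (b - r))) \<partial>lborel)"
      proof (rule nn_integral_cong)
        fix r :: real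
        show "ennreal (J (r *\<^sub>R u)) * indicator S (r *\<^sub>R u) * ennreal (r ^ (?n - 1)) * indicator {0<..} r =
          ennreal (J u) * (ennreal (r ^ m) * (indicator {0<..} r * indicator {0<..} (b - r)))"
        proof (cases "r > 0")
          case True
          have "ennreal (J (r *\<^sub>R u)) * ennreal (r ^ (?n - 1)) = ennreal (J u) * ennreal (r ^ m)"
            unfolding hom_jac[OF True] m_def power_add using True J
            by (simp add: ennreal_mult[symmetric] mult_ac)
          then show ?thesis
            using True S_iff[of r] by (auto simp: indicator_def mult_ac)
        qed auto
      qed
      also have "\<dots> = ennreal (J u) * ennreal (b ^ (?n * d) / (?n * d))"
        using nn_integral_power_Ioo[of b m] b unfolding Suc_m
        by (subst nn_integral_cmult) (simp_all del: power_Suc)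
      also have "b ^ (?n * d) = 1 / norm (\<Psi> u) ^ ?n"
        using b(2) by (metis mult.commute power_mult power_one_over)
      also have "ennreal (J u) * ennreal (1 / norm (\<Psi> u) ^ ?n / (?n * d)) =
          ennreal (J u / (d * norm (\<Psi> u) ^ ?n)) / ?n"
      proof -
        have "ennreal (J u / (d * norm (\<Psi> u) ^ ?n)) / ennreal ?n = ennreal (J u / (d * norm (\<Psi> u) ^ ?n) / ?n)"
          using J by (intro divide_ennreal) auto
        then show ?thesis
          using J by (simp add: ennreal_mult[symmetric] ennreal_of_nat_eq_real_of_nat field_simps)
      qed
      finally show ?thesis using True by simp
    qed
  qed
  also have "\<dots> = (\<integral>\<^sup>+u. ennreal (J u / (d * norm (\<Psi> u) ^ ?n)) * indicator H u * indicator A (sgn (\<Psi> u)) \<partial>sphere_measure) / ?n"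
    by (rule nn_integral_divide, rule measurable_sphere_measureI) measurable
  finally have vol: "emeasure lebesgue E = \<dots>" .
  have "emeasure sphere_measure A = ?n * emeasure lebesgue E"
  proof -
    have "emeasure sphere_measure A = (\<integral>\<^sup>+u. indicator A u \<partial>sphere_measure)"
      using A by simp
    also have "\<dots> = ?n * (\<integral>\<^sup>+z. indicator A (sgn z) * indicator (ball 0 1 - {0}) z \<partial>lborel)"
      using A by (subst nn_integral_sphere_measure) auto
    also have "(\<integral>\<^sup>+z. indicator A (sgn z) * indicator (ball 0 1 - {0}) z \<partial>lborel) =
        (\<integral>\<^sup>+z. indicator E z \<partial>lborel)"
      by (rule nn_integral_cong) (use E_nz in \<open>auto simp: indicator_def E_def\<close>)
    finally show ?thesis by simp
  qed
  then show ?thesis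
    unfolding vol by (simp add: ennreal_times_divide mult.commute[of "of_nat ?n"] ennreal_mult_divide_eq)
qed

section \<open>Determinants of low-rank perturbations\<close>

text \<open>An orthogonal conjugation moves \<open>v\<close> to a coordinate axis. The matrix then differs from the
  identity in a single column, and its determinant is given by Cramer's rule.\<close>

lemma det_matrix_rank_one_update:
  fixes u v :: "real^'n"
  shows "det (matrix (\<lambda>x. x + (v \<bullet> x) *\<^sub>R u)) = 1 + v \<bullet> u"
proof -
  obtain m :: 'n where True by blast
  obtain f :: "real^'n \<Rightarrow> real^'n" where f: "orthogonal_transformation f" "f (axis m (norm v)) = v"
    using orthogonal_transformation_exists[of "axis m (norm v)" v] by (auto simp: norm_eq_sqrt_inner inner_axis_axis)
  define g where "g = inv f"
  have g: "orthogonal_transformation g" "f (g x) = x" "g (f x) = x" for x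
    using f(1) orthogonal_transformation_inv orthogonal_transformation_bij[OF f(1)]
    by (auto simp: g_def bij_inv_eq_iff bij_is_inj bij_is_surj surj_f_inv_f)
  have lin: "linear f" "linear g" "linear (\<lambda>x. x + (v \<bullet> x) *\<^sub>R u)"
    using f(1) g(1) by (simp_all add: orthogonal_transformation_linear)
      (simp add: linear_iff algebra_simps inner_add_right)
  define w where "w = g u"
  have vf: "v \<bullet> f x = norm v * x $ m" for x
    using f unfolding orthogonal_transformation_def by (metis inner_axis' real_inner_1_right inner_real_def)
  have conj: "g \<circ> ((\<lambda>x. x + (v \<bullet> x) *\<^sub>R u) \<circ> f) = (\<lambda>x. x + (norm v * x $ m) *\<^sub>R w)"
    using lin(2) by (auto simp: fun_eq_iff vf w_def linear_add linear_scale g)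
  have "det (matrix g) * det (matrix f) = det (matrix (g \<circ> f))"
    by (simp add: matrix_compose[OF lin(1) lin(2)] det_mul)
  also have "g \<circ> f = id" by (auto simp: g)
  finally have gf: "det (matrix g) * det (matrix f) = 1"
    by (simp only: matrix_id_mat_1 det_I)
  have "det (matrix (\<lambda>x. x + (norm v * x $ m) *\<^sub>R w)) =
      det (matrix g) * (det (matrix (\<lambda>x. x + (v \<bullet> x) *\<^sub>R u)) * det (matrix f))"
    unfolding conj[symmetric] using lin by (simp add: matrix_compose linear_compose det_mul)
  also have "\<dots> = det (matrix (\<lambda>x. x + (v \<bullet> x) *\<^sub>R u))"
    using gf by (simp add: algebra_simps)
  also have "matrix (\<lambda>x. x + (norm v * x $ m) *\<^sub>R w) =
     (\<chi> i j. if j = m then (mat 1 *v (axis m 1 + norm v *\<^sub>R w)) $ i else mat 1 $ i $ j)"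
    unfolding matrix_vector_mul_lid by (auto simp: vec_eq_iff matrix_def mat_def axis_def)
  also have "det \<dots> = 1 + norm v * w $ m"
    by (subst cramer_lemma) simp
  also have "norm v * w $ m = v \<bullet> u"
    using vf[of w] by (simp add: w_def g)
  finally show ?thesis by simp
qed

text \<open>This is the derivative of \<open>z \<mapsto> |z|\<^sup>2 k - 2 (k \<bullet> z) z\<close>. With \<open>\<alpha> = - 2 (k \<bullet> z)\<close>
  it is \<open>\<alpha>\<close> times a product of two rank-one perturbations of the identity. The order
  of the factors matters: splitting off \<open>k z\<^sup>T\<close> on the left first would give a singular factor, since
  \<open>1 + (2 / \<alpha>) (k \<bullet> z) = 0\<close>.\<close>

lemma det_matrix_skew_rank_two_update:
  fixes k z :: "real^'n"
  assumes "CARD('n) \<ge> 2" and k: "norm k = 1" and kz: "k \<bullet> z \<noteq> 0"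
  shows "det (matrix (\<lambda>h. (2 * (z \<bullet> h)) *\<^sub>R k - (2 * (k \<bullet> h)) *\<^sub>R z - (2 * (k \<bullet> z)) *\<^sub>R h)) =
    4 * (- 2 * (k \<bullet> z)) ^ (CARD('n) - 2) * (norm z)\<^sup>2"
proof -
  define \<alpha> where "\<alpha> = - 2 * (k \<bullet> z)"
  have \<alpha>: "\<alpha> \<noteq> 0" and kz': "k \<bullet> z = - \<alpha> / 2"
    using kz by (auto simp: \<alpha>_def)
  have kk: "k \<bullet> k = 1" using k by (simp add: norm_eq_1)
  \<comment> \<open>The preimage of \<open>(2 / \<alpha>) k\<close> under the left factor \<open>?F\<close>.\<close>
  define y where "y = (2 / \<alpha>) *\<^sub>R k + (2 / \<alpha>\<^sup>2) *\<^sub>R z"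
  let ?F = "\<lambda>h. h + (k \<bullet> h) *\<^sub>R ((- 2 / \<alpha>) *\<^sub>R z)"
  let ?G = "\<lambda>h. h + (z \<bullet> h) *\<^sub>R y"
  have lin: "linear ((*\<^sub>R) \<alpha> :: real^'n \<Rightarrow> _)" "linear ?F" "linear ?G"
    by (auto simp: linear_iff algebra_simps inner_add_right add_divide_distrib)
  have Fy: "?F y = (2 / \<alpha>) *\<^sub>R k"
  proof -
    have "k \<bullet> y = 1 / \<alpha>"
      using \<alpha> by (simp add: y_def inner_add_right kk kz' power2_eq_square field_simps)
    then show ?thesis
      by (simp add: y_def power2_eq_square algebra_simps)
  qed
  have "(\<lambda>h. (2 * (z \<bullet> h)) *\<^sub>R k - (2 * (k \<bullet> h)) *\<^sub>R z - (2 * (k \<bullet> z)) *\<^sub>R h) = (*\<^sub>R) \<alpha> \<circ> (?F \<circ> ?G)"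
  proof
    fix h
    have "(?F \<circ> ?G) h = ?F h + (z \<bullet> h) *\<^sub>R ?F y"
      by (simp add: inner_add_right algebra_simps add_divide_distrib)
    also have "\<dots> = ?F h + (z \<bullet> h) *\<^sub>R ((2 / \<alpha>) *\<^sub>R k)"
      by (simp only: Fy)
    finally have "((*\<^sub>R) \<alpha> \<circ> (?F \<circ> ?G)) h = \<alpha> *\<^sub>R (?F h + (z \<bullet> h) *\<^sub>R ((2 / \<alpha>) *\<^sub>R k))"
      by (simp only: o_apply)
    also have "\<dots> = \<alpha> *\<^sub>R h - (2 * (k \<bullet> h)) *\<^sub>R z + (2 * (z \<bullet> h)) *\<^sub>R k"
      using \<alpha> by (simp add: scaleR_add_right scaleR_diff_right mult.commute)
    also have "\<dots> = (2 * (z \<bullet> h)) *\<^sub>R k - (2 * (k \<bullet> h)) *\<^sub>R z - (2 * (k \<bullet> z)) *\<^sub>R h"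
      by (simp add: \<alpha>_def)
    finally show "(2 * (z \<bullet> h)) *\<^sub>R k - (2 * (k \<bullet> h)) *\<^sub>R z - (2 * (k \<bullet> z)) *\<^sub>R h = ((*\<^sub>R) \<alpha> \<circ> (?F \<circ> ?G)) h" ..
  qed
  then have "det (matrix (\<lambda>h. (2 * (z \<bullet> h)) *\<^sub>R k - (2 * (k \<bullet> h)) *\<^sub>R z - (2 * (k \<bullet> z)) *\<^sub>R h)) =
     \<alpha> ^ CARD('n) * (det (matrix ?F) * det (matrix ?G))"
    by (simp only: matrix_compose[OF lin(3,2)] matrix_compose[OF linear_compose[OF lin(3,2)] lin(1)] det_mul det_matrix_scaleR)
  also have "det (matrix ?F) = 2"
    using \<alpha> by (subst det_matrix_rank_one_update) (simp add: kz')
  also have "det (matrix ?G) = 2 * (norm z)\<^sup>2 / \<alpha>\<^sup>2"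
    using \<alpha> by (subst det_matrix_rank_one_update)
      (simp add: y_def inner_add_right inner_commute[of z k] kz' power2_norm_eq_inner)
  also have "\<alpha> ^ CARD('n) = \<alpha> ^ (CARD('n) - 2) * \<alpha>\<^sup>2"
    using assms(1) by (metis le_add_diff_inverse2 power_add)
  finally show ?thesis
    using \<alpha> by (simp add: \<alpha>_def)
qed

text \<open>By polarization \<open>N\<^sup>T N\<close> is the rank-one perturbation \<open>1 - b b\<^sup>T\<close> of the identity, so the square of
  the determinant is \<open>1 - |b|\<^sup>2\<close>.\<close>

lemma abs_det_of_norm_defect:
  fixes N :: "real^'n \<Rightarrow> real^'n"
  assumes "linear N" and norm_N: "\<And>x. (norm (N x))\<^sup>2 = (norm x)\<^sup>2 - (b \<bullet> x)\<^sup>2"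
  shows "\<bar>det (matrix N)\<bar> = sqrt (1 - (norm b)\<^sup>2)"
proof -
  have polar: "N x \<bullet> N y = x \<bullet> y - (b \<bullet> x) * (b \<bullet> y)" for x y
  proof -
    have "2 * (N x \<bullet> N y) = (norm (N (x + y)))\<^sup>2 - (norm (N x))\<^sup>2 - (norm (N y))\<^sup>2"
      unfolding linear_add[OF assms(1)] power2_norm_eq_inner by (simp add: inner_simps inner_commute)
    also have "\<dots> = 2 * (x \<bullet> y - (b \<bullet> x) * (b \<bullet> y))"
      unfolding norm_N unfolding power2_norm_eq_inner by (simp add: inner_simps inner_commute power2_eq_square algebra_simps)
    finally show ?thesis by simp
  qed
  have "adjoint N \<circ> N = (\<lambda>x. x + (b \<bullet> x) *\<^sub>R (- b))"
  proof
    fix x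
    have "y \<bullet> (adjoint N \<circ> N) x = y \<bullet> (x + (b \<bullet> x) *\<^sub>R (- b))" for y
      using adjoint_works[OF assms(1), of y "N x"] by (simp add: polar inner_simps inner_commute)
    then show "(adjoint N \<circ> N) x = x + (b \<bullet> x) *\<^sub>R (- b)"
      by (rule vector_eq_ldot[THEN iffD1, OF allI])
  qed
  then have "det (matrix (adjoint N \<circ> N)) = 1 - (norm b)\<^sup>2"
    by (simp add: det_matrix_rank_one_update[of b "- b", simplified] power2_norm_eq_inner)
  moreover have "det (matrix (adjoint N \<circ> N)) = (det (matrix N))\<^sup>2"
    using assms(1) by (simp add: matrix_compose adjoint_linear det_mul matrix_adjoint power2_eq_square)
  ultimately have "(det (matrix N))\<^sup>2 = 1 - (norm b)\<^sup>2" by simp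
  then show ?thesis
    by (metis real_sqrt_abs)
qed

section \<open>Mirror images of a fixed unit vector\<close>

text \<open>The reflection of \<open>k\<close> in the hyperplane orthogonal to \<open>z\<close>.\<close>

definition reflect_along :: "'a::euclidean_space \<Rightarrow> 'a \<Rightarrow> 'a" where
  "reflect_along z k = k - (2 * (k \<bullet> z) / (norm z)\<^sup>2) *\<^sub>R z"

text \<open>Multiplication by \<open>|z|\<^sup>2\<close> makes the mirror image of \<open>k\<close> a polynomial in \<open>z\<close>, homogeneous of
  degree two, with the same direction.\<close>

definition scaled_reflection :: "'a::euclidean_space \<Rightarrow> 'a \<Rightarrow> 'a" where
  "scaled_reflection k z = (norm z)\<^sup>2 *\<^sub>R k - (2 * (k \<bullet> z)) *\<^sub>R z"

lemma scaled_reflection_eq: "scaled_reflection k z = (norm z)\<^sup>2 *\<^sub>R reflect_along z k"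
  by (simp add: scaled_reflection_def reflect_along_def scaleR_diff_right)

lemma norm_reflect_along: "norm (reflect_along z k) = norm k"
proof (cases "z = 0")
  case False
  have "(norm (reflect_along z k))\<^sup>2 = (norm k)\<^sup>2"
    using False unfolding reflect_along_def power2_norm_eq_inner
    by (simp add: inner_diff inner_commute field_simps power2_eq_square)
  then show ?thesis
    by (simp add: power2_eq_iff_nonneg)
qed (simp add: reflect_along_def)

lemma borel_measurable_reflect_along [measurable]:
  "(\<lambda>z. reflect_along z k) \<in> borel_measurable borel"
  unfolding reflect_along_def by measurable

lemma norm_scaled_reflection: "norm (scaled_reflection k z) = (norm z)\<^sup>2 * norm k"
  by (simp add: scaled_reflection_eq norm_reflect_along)

lemma sgn_scaled_reflection:
  assumes "norm k = 1" "z \<noteq> 0"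
  shows "sgn (scaled_reflection k z) = reflect_along z k"
  using assms by (simp add: scaled_reflection_eq sgn_scaleR) (simp add: sgn_div_norm norm_reflect_along)

lemma has_derivative_scaled_reflection:
  "(scaled_reflection k has_derivative
     (\<lambda>h. (2 * (z \<bullet> h)) *\<^sub>R k - (2 * (k \<bullet> h)) *\<^sub>R z - (2 * (k \<bullet> z)) *\<^sub>R h)) (at z)"
  unfolding scaled_reflection_def power2_norm_eq_inner
  by (auto intro!: derivative_eq_intros simp: algebra_simps inner_commute)

text \<open>The norm of the image determines \<open>|z|\<close>, hence the vector \<open>(k \<bullet> z) z\<close>; its product with \<open>k\<close>
  is \<open>(k \<bullet> z)\<^sup>2\<close>, which determines \<open>k \<bullet> z\<close> up to the sign that the half-space fixes.\<close>

lemma inj_on_scaled_reflection: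
  assumes k: "norm k = 1"
  shows "inj_on (scaled_reflection k) {z. k \<bullet> z > 0}"
proof (rule inj_onI)
  fix x y assume x: "x \<in> {z. k \<bullet> z > 0}" and y: "y \<in> {z. k \<bullet> z > 0}"
    and eq: "scaled_reflection k x = scaled_reflection k y"
  have "norm x = norm y"
    using arg_cong[OF eq, of norm] k by (simp add: norm_scaled_reflection power2_eq_iff_nonneg)
  with eq have "(2 * (k \<bullet> x)) *\<^sub>R x = (2 * (k \<bullet> y)) *\<^sub>R y"
    by (simp add: scaled_reflection_def)
  from arg_cong[OF this, of "(*\<^sub>R) (1 / 2)"] have v: "(k \<bullet> x) *\<^sub>R x = (k \<bullet> y) *\<^sub>R y"
    by simp
  from arg_cong[OF v, of "inner k"] have "(k \<bullet> x)\<^sup>2 = (k \<bullet> y)\<^sup>2"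
    by (simp add: power2_eq_square)
  with x y have "k \<bullet> x = k \<bullet> y"
    by (simp add: power2_eq_iff_nonneg)
  with v x show "x = y" by simp
qed

text \<open>A vector \<open>y\<close> is the mirror image of \<open>|y| k\<close> in the hyperplane orthogonal to
  \<open>|y| k - y\<close>; the length of \<open>z\<close> is then dictated by \<open>|z|\<^sup>2 = |y|\<close>.\<close>

lemma scaled_reflection_image:
  assumes k: "norm k = 1" and y: "y \<notin> span {k}"
  shows "y \<in> scaled_reflection k ` {z. k \<bullet> z > 0}"
proof -
  have ky: "k \<bullet> y < norm y"
  proof -
    have "k \<bullet> y \<noteq> norm y"
    proof
      assume "k \<bullet> y = norm y"
      then have "norm k *\<^sub>R y = norm y *\<^sub>R k"
        using norm_cauchy_schwarz_eq[of k y] k by simp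
      then have "y = norm y *\<^sub>R k" using k by simp
      with y show False
        by (metis span_base span_scale singletonI)
    qed
    then show ?thesis
      using norm_cauchy_schwarz[of k y] k by simp
  qed
  \<comment> \<open>This is going to be \<open>k \<bullet> z\<close>.\<close>
  define m where "m = sqrt ((norm y - k \<bullet> y) / 2)"
  have m: "m > 0" "m\<^sup>2 = (norm y - k \<bullet> y) / 2"
    using ky by (auto simp: m_def)
  define z where "z = (1 / (2 * m)) *\<^sub>R (norm y *\<^sub>R k - y)"
  have kk: "k \<bullet> k = 1" using k by (simp add: norm_eq_1)
  have "k \<bullet> z = (norm y - k \<bullet> y) / (2 * m)"
    by (simp add: z_def inner_diff_right kk)
  also have "norm y - k \<bullet> y = 2 * m\<^sup>2" using m by simp
  finally have kz: "k \<bullet> z = m" using m by (simp add: power2_eq_square)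
  have "(norm z)\<^sup>2 = (1 / (2 * m))\<^sup>2 * (norm (norm y *\<^sub>R k - y))\<^sup>2"
    by (simp add: z_def power_mult_distrib power_divide)
  also have "(norm (norm y *\<^sub>R k - y))\<^sup>2 = 2 * norm y * (norm y - k \<bullet> y)"
    by (simp add: power2_norm_eq_inner inner_diff inner_commute kk)
      (simp add: power2_norm_eq_inner[symmetric] power2_eq_square algebra_simps)
  also have "\<dots> = norm y * (2 * m)\<^sup>2"
    using m by (simp add: power_mult_distrib)
  finally have "(norm z)\<^sup>2 = norm y"
    using m(1) by (simp add: power_divide power_mult_distrib)
  then have "scaled_reflection k z = norm y *\<^sub>R k - (norm y *\<^sub>R k - y)"
    using m by (simp add: scaled_reflection_def kz) (simp add: z_def)
  then show ?thesis
    using m kz by (intro image_eqI[of _ _ z]) auto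
qed

text \<open>By Cauchy-Schwarz, the defect \<open>(b \<bullet> x)\<^sup>2\<close> is smaller than \<open>|x|\<^sup>2\<close>.\<close>

lemma norm_defect_nonzero:
  fixes N :: "'a::euclidean_space \<Rightarrow> 'a"
  assumes "(norm (N x))\<^sup>2 = (norm x)\<^sup>2 - (b \<bullet> x)\<^sup>2" "norm b < 1" "x \<noteq> 0"
  shows "N x \<noteq> 0"
proof
  assume "N x = 0"
  then have "(norm x)\<^sup>2 = \<bar>b \<bullet> x\<bar>\<^sup>2"
    using assms(1) by simp
  also have "\<dots> \<le> (norm b * norm x)\<^sup>2"
    by (intro power_mono Cauchy_Schwarz_ineq2) auto
  also have "\<dots> < (1 * norm x)\<^sup>2"
    using assms by (intro power_strict_mono mult_strict_right_mono) auto
  finally show False by simp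
qed

text \<open>The homogeneous map here is \<open>x \<mapsto> |N x|\<^sup>2 k - 2 (k \<bullet> N x) N x\<close> of degree two. Already the
  half-space \<open>k \<bullet> N x > 0\<close> covers everything outside the line spanned by \<open>k\<close>, which is a null set
  because the dimension is at least two.\<close>

lemma emeasure_sphere_reflection_half_enumerated:
  fixes N :: "real^'n::{finite,wellorder} \<Rightarrow> real^'n::_"
  assumes n: "CARD('n) \<ge> 2" and N: "linear N"
    and norm_N: "\<And>x. (norm (N x))\<^sup>2 = (norm x)\<^sup>2 - (b \<bullet> x)\<^sup>2" and b: "norm b < 1"
    and k: "norm k = 1" and A: "A \<in> sets sphere_measure"
  shows "emeasure sphere_measure A =
    (\<integral>\<^sup>+u. ennreal (2 * sqrt (1 - (norm b)\<^sup>2) * \<bar>2 * (k \<bullet> N u)\<bar> ^ (CARD('n) - 2) / (norm (N u)) ^ (2 * CARD('n) - 2))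
       * indicator {0<..} (k \<bullet> N u) * indicator A (reflect_along (N u) k) \<partial>sphere_measure)"
proof -
  let ?n = "CARD('n)"
  let ?\<Psi> = "scaled_reflection k \<circ> N"
  let ?D = "\<lambda>z h. (2 * (z \<bullet> h)) *\<^sub>R k - (2 * (k \<bullet> h)) *\<^sub>R z - (2 * (k \<bullet> z)) *\<^sub>R h"
  define H where "H = {x. k \<bullet> N x > 0}"
  define J where "J x = sqrt (1 - (norm b)\<^sup>2) * (4 * \<bar>2 * (k \<bullet> N x)\<bar> ^ (?n - 2) * (norm (N x))\<^sup>2)" for x
  have N_borel [measurable]: "N \<in> borel_measurable borel"
    using N by (rule linear_borel_measurable)
  have N_0: "N x = 0 \<longleftrightarrow> x = 0" for x
    using norm_defect_nonzero[of N x b, OF norm_N b] linear_0[OF N] by blast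
  have N_inj: "inj N"
    using N_0 linear_injective_0[OF N] by blast
  then have N_surj: "surj N"
    using linear_injective_imp_surjective[OF N] by blast
  have "emeasure sphere_measure A = (\<integral>\<^sup>+u. ennreal (J u / (real 2 * norm (?\<Psi> u) ^ ?n)) * indicator H u *
      indicator A (sgn (?\<Psi> u)) \<partial>sphere_measure)"
  proof (rule emeasure_sphere_homogeneous_map[where \<Psi>' = "\<lambda>x. ?D (N x) \<circ> N"])
    show "H \<in> sets borel" unfolding H_def by measurable
    show "?\<Psi> \<in> borel_measurable borel"
      unfolding comp_def scaled_reflection_def by measurable
    show "J \<in> borel_measurable borel"
      unfolding J_def by measurable
    show "r *\<^sub>R x \<in> H" if "x \<in> H" "r > 0" for x r
      using that by (simp add: H_def linear_scale[OF N])
    show "(?\<Psi> has_derivative ?D (N x) \<circ> N) (at x)" for x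
      using N by (intro diff_chain_at has_derivative_scaled_reflection)
        (simp add: linear_imp_has_derivative)
    show "\<bar>det (matrix (?D (N x) \<circ> N))\<bar> = J x" if "x \<in> H" for x
    proof -
      have "linear (?D (N x))"
        by (auto simp: linear_iff algebra_simps inner_add_right)
      then have "\<bar>det (matrix (?D (N x) \<circ> N))\<bar> = \<bar>det (matrix (?D (N x)))\<bar> * sqrt (1 - (norm b)\<^sup>2)"
        using N abs_det_of_norm_defect[OF N norm_N] by (simp add: matrix_compose det_mul abs_mult)
      also have "k \<bullet> N x \<noteq> 0" using that by (auto simp: H_def)
      then have "\<bar>det (matrix (?D (N x)))\<bar> = 4 * \<bar>2 * (k \<bullet> N x)\<bar> ^ (?n - 2) * (norm (N x))\<^sup>2"
        by (subst det_matrix_skew_rank_two_update[OF n k]) (auto simp: abs_mult power_abs)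
      finally show ?thesis by (simp only: J_def mult.commute)
    qed
    show "inj_on ?\<Psi> H"
      by (rule comp_inj_on) (auto simp: H_def intro: inj_on_subset[OF N_inj] inj_on_subset[OF inj_on_scaled_reflection[OF k]])
    have "N ` H = {z. k \<bullet> z > 0}"
      using N_surj by (auto simp: H_def surj_def)
    then have "- (?\<Psi> ` H) \<subseteq> span {k}"
      using scaled_reflection_image[OF k] by (force simp: image_comp[symmetric])
    moreover have "negligible (span {k})"
      using n dim_le_card[of "span {k}" "{k}"] by (intro negligible_lowdim) simp
    ultimately show "negligible (- (?\<Psi> ` H))"
      using negligible_subset by blast
    show "?\<Psi> x \<noteq> 0" if "x \<in> H" for x
    proof -
      have "norm (?\<Psi> x) > 0"
        using that k by (auto simp: H_def norm_scaled_reflection)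
      then show ?thesis by force
    qed
    show "?\<Psi> (r *\<^sub>R x) = r ^ 2 *\<^sub>R ?\<Psi> x" for x r
      by (simp add: linear_scale[OF N] scaled_reflection_def power2_eq_square algebra_simps)
    show "J (r *\<^sub>R x) = r ^ (CARD('n) * (2 - 1)) * J x" if "r > 0" for x r
    proof -
      have "r ^ CARD('n) = r ^ (CARD('n) - 2) * r\<^sup>2"
        using n by (metis le_add_diff_inverse2 power_add)
      then show ?thesis
        using that by (simp add: J_def linear_scale[OF N] abs_mult power_mult_distrib)
    qed
  qed (use A in auto)
  also have "\<dots> = (\<integral>\<^sup>+u. ennreal (2 * sqrt (1 - (norm b)\<^sup>2) * \<bar>2 * (k \<bullet> N u)\<bar> ^ (CARD('n) - 2) / (norm (N u)) ^ (2 * CARD('n) - 2))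
       * indicator {0<..} (k \<bullet> N u) * indicator A (reflect_along (N u) k) \<partial>sphere_measure)"
  proof (rule nn_integral_cong)
    fix u :: "real^'n::_"
    assume "u \<in> space sphere_measure"
    then have "u \<noteq> 0" by auto
    then have Nu: "norm (N u) > 0" "N u \<noteq> 0" using N_0 by auto
    have "2 * ?n = 2 + (2 * ?n - 2)" using n by simp
    then have "norm (N u) ^ (2 * ?n) = (norm (N u))\<^sup>2 * norm (N u) ^ (2 * ?n - 2)"
      by (metis power_add)
    then have "J u / (real 2 * norm (?\<Psi> u) ^ ?n) =
      2 * sqrt (1 - (norm b)\<^sup>2) * \<bar>2 * (k \<bullet> N u)\<bar> ^ (CARD('n) - 2) / (norm (N u)) ^ (2 * CARD('n) - 2)"
      using Nu k by (simp add: J_def norm_scaled_reflection flip: power_mult)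
    moreover have "sgn (?\<Psi> u) = reflect_along (N u) k"
      using sgn_scaled_reflection[OF k Nu(2)] by simp
    moreover have "indicator H u = (indicator {0<..} (k \<bullet> N u) :: ennreal)"
      by (simp add: H_def indicator_def)
    ultimately show "ennreal (J u / (real 2 * norm (?\<Psi> u) ^ ?n)) * indicator H u * indicator A (sgn (?\<Psi> u)) =
      ennreal (2 * sqrt (1 - (norm b)\<^sup>2) * \<bar>2 * (k \<bullet> N u)\<bar> ^ (CARD('n) - 2) / (norm (N u)) ^ (2 * CARD('n) - 2))
       * indicator {0<..} (k \<bullet> N u) * indicator A (reflect_along (N u) k)"
      by simp
  qed
  finally show ?thesis .
qed

section \<open>Transfer to coordinates without a preferred order\<close>

text \<open>The change-of-variables formula refers to well-ordered coordinates. A copy of the index type,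
  ordered by an arbitrary enumeration, provides such an order. The relabelling of coordinates is an
  isometry that preserves Lebesgue measure, so results on the sphere whose statement is free of
  coordinates can be transferred along it.\<close>

typedef 'a enumerated = "UNIV :: 'a set" ..

instantiation enumerated :: (finite) wellorder
begin

definition less_eq_enumerated :: "'a enumerated \<Rightarrow> 'a enumerated \<Rightarrow> bool" where
  "x \<le> y \<longleftrightarrow> to_nat_on UNIV (Rep_enumerated x) \<le> to_nat_on UNIV (Rep_enumerated y)"

definition less_enumerated :: "'a enumerated \<Rightarrow> 'a enumerated \<Rightarrow> bool" where
  "x < y \<longleftrightarrow> to_nat_on UNIV (Rep_enumerated x) < to_nat_on UNIV (Rep_enumerated y)"

instance
proof
  fix x y z :: "'a enumerated" and P
  show "x < y \<longleftrightarrow> x \<le> y \<and> \<not> y \<le> x" "x \<le> x" "x \<le> y \<or> y \<le> x"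
    "x \<le> y \<Longrightarrow> y \<le> z \<Longrightarrow> x \<le> z"
    by (auto simp: less_eq_enumerated_def less_enumerated_def)
  show "x = y" if "x \<le> y" "y \<le> x"
  proof -
    have "to_nat_on UNIV (Rep_enumerated x) = to_nat_on UNIV (Rep_enumerated y)"
      using that by (simp add: less_eq_enumerated_def)
    then have "Rep_enumerated x = Rep_enumerated y"
      by (simp add: countable_finite)
    then show ?thesis
      by (simp add: Rep_enumerated_inject)
  qed
  assume step: "\<And>x :: 'a enumerated. (\<And>y. y < x \<Longrightarrow> P y) \<Longrightarrow> P x"
  show "P z"
  proof (induction z rule: measure_induct_rule[of "\<lambda>z. to_nat_on UNIV (Rep_enumerated z)"])
    case (less x)
    show ?case
      by (rule step) (rule less, simp add: less_enumerated_def)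
  qed
qed

end

instance enumerated :: (finite) finite
proof
  have "surj (Abs_enumerated :: 'a \<Rightarrow> 'a enumerated)"
    by (metis Rep_enumerated_inverse surj_def)
  then show "finite (UNIV :: 'a enumerated set)"
    by (metis finite_code finite_imageI)
qed

definition enumerate_vec :: "real^'n \<Rightarrow> real^('n::finite) enumerated" where
  "enumerate_vec x = (\<chi> i. x $ Rep_enumerated i)"

definition unenumerate_vec :: "real^('n::finite) enumerated \<Rightarrow> real^'n" where
  "unenumerate_vec x = (\<chi> i. x $ Abs_enumerated i)"

lemma enumerate_vec_inverse [simp]:
  "unenumerate_vec (enumerate_vec x) = x" "enumerate_vec (unenumerate_vec y) = y"
  by (simp_all add: enumerate_vec_def unenumerate_vec_def vec_eq_iff
      Abs_enumerated_inverse Rep_enumerated_inverse)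

lemma bij_Rep_enumerated: "bij (Rep_enumerated :: 'a enumerated \<Rightarrow> 'a)"
  by (metis Abs_enumerated_inverse Rep_enumerated_inverse UNIV_I bij_betw_def inj_on_inverseI surj_def)

lemma CARD_enumerated [simp]: "CARD('a::finite enumerated) = CARD('a)"
  using bij_betw_same_card[OF bij_Rep_enumerated] .

lemma linear_enumerate_vec: "linear enumerate_vec" "linear unenumerate_vec"
  by (auto simp: linear_iff enumerate_vec_def unenumerate_vec_def vec_eq_iff)

lemma inner_enumerate_vec [simp]: "enumerate_vec x \<bullet> enumerate_vec y = x \<bullet> y"
proof -
  have "(\<Sum>i\<in>UNIV. x $ Rep_enumerated i * y $ Rep_enumerated i) = (\<Sum>i\<in>UNIV. x $ i * y $ i)"
    using bij_Rep_enumerated by (rule sum.reindex_bij_betw)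
  then show ?thesis by (simp add: inner_vec_def enumerate_vec_def)
qed

lemma norm_enumerate_vec [simp]: "norm (enumerate_vec x) = norm x"
  by (simp add: norm_eq_sqrt_inner)

lemma inner_unenumerate_vec: "unenumerate_vec x \<bullet> unenumerate_vec y = x \<bullet> y"
  by (metis enumerate_vec_inverse(2) inner_enumerate_vec)

lemma norm_unenumerate_vec [simp]: "norm (unenumerate_vec x) = norm x"
  by (simp add: norm_eq_sqrt_inner inner_unenumerate_vec)

lemma borel_enumerate_vec [measurable]:
  "enumerate_vec \<in> borel_measurable borel" "unenumerate_vec \<in> borel_measurable borel"
  by (auto intro!: borel_measurable_continuous_onI linear_continuous_on
      linear_enumerate_vec simp: linear_conv_bounded_linear[symmetric])

lemma prod_Basis_vec:
  fixes x :: "real^'n"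
  shows "(\<Prod>b\<in>Basis. x \<bullet> b) = (\<Prod>i\<in>UNIV. x $ i)"
proof -
  have B: "Basis = range (\<lambda>i. axis i 1 :: real^'n)"
    by (auto simp: Basis_vec_def)
  have inj: "inj (\<lambda>i. axis i 1 :: real^'n)"
    by (auto simp: inj_on_def axis_eq_axis)
  show ?thesis
    unfolding B by (simp add: prod.reindex[OF inj] inner_axis)
qed

text \<open>The relabelling permutes the edge lengths of boxes.\<close>

lemma lborel_enumerate_vec: "distr lborel borel enumerate_vec = lborel"
proof (rule lborel_eqI[symmetric])
  fix l u :: "real^('n::finite) enumerated"
  assume le_Basis: "\<And>b. b \<in> Basis \<Longrightarrow> l \<bullet> b \<le> u \<bullet> b"
  have le: "l $ i \<le> u $ i" for i
    using le_Basis[of "axis i 1"] by (simp add: inner_axis)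
  have "enumerate_vec -` box l u = box (unenumerate_vec l) (unenumerate_vec u)"
  proof -
    have "(\<forall>i. l $ i < x $ Rep_enumerated i \<and> x $ Rep_enumerated i < u $ i) \<longleftrightarrow>
        (\<forall>j. l $ Abs_enumerated j < x $ j \<and> x $ j < u $ Abs_enumerated j)" for x :: "real^'n"
      by (metis Abs_enumerated_inverse Rep_enumerated_inverse UNIV_I)
    then show ?thesis
      by (auto simp: mem_box_cart enumerate_vec_def unenumerate_vec_def)
  qed
  then have "emeasure (distr lborel borel enumerate_vec) (box l u) =
      emeasure lborel (box (unenumerate_vec l) (unenumerate_vec u))"
    by (simp add: emeasure_distr)
  also have "\<dots> = ennreal (\<Prod>b\<in>Basis. (unenumerate_vec u - unenumerate_vec l) \<bullet> b)"
    by (subst emeasure_lborel_box) (auto simp: Basis_vec_def inner_axis unenumerate_vec_def le)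
  also have "\<dots> = ennreal (\<Prod>i\<in>UNIV. (unenumerate_vec u - unenumerate_vec l) $ i)"
    by (rule arg_cong[OF prod_Basis_vec])
  also have "\<dots> = ennreal (\<Prod>i\<in>UNIV. (u - l) $ i)"
    using prod.reindex_bij_betw[OF bij_Rep_enumerated, of "\<lambda>i. (unenumerate_vec u - unenumerate_vec l) $ i"]
    by (simp add: unenumerate_vec_def Rep_enumerated_inverse)
  also have "\<dots> = ennreal (\<Prod>b\<in>Basis. (u - l) \<bullet> b)"
    by (rule arg_cong[OF prod_Basis_vec[symmetric]])
  finally show "emeasure (distr lborel borel enumerate_vec) (box l u) = ennreal (\<Prod>b\<in>Basis. (u - l) \<bullet> b)" .
qed simp

lemma nn_integral_sphere_enumerate_vec:
  fixes g :: "real^('n::finite) enumerated \<Rightarrow> ennreal"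
  assumes [measurable]: "g \<in> borel_measurable borel"
  shows "(\<integral>\<^sup>+u. g u \<partial>sphere_measure) = (\<integral>\<^sup>+u. g (enumerate_vec u) \<partial>sphere_measure)"
proof -
  have [measurable]: "(sgn :: real^'n enumerated \<Rightarrow> _) \<in> borel_measurable borel"
    unfolding sgn_div_norm by measurable
  define B :: "(real^'n enumerated) set" where "B = ball 0 1 - {0}"
  have [measurable]: "B \<in> sets borel" by (simp add: B_def)
  have "(\<integral>\<^sup>+u. g u \<partial>sphere_measure) = CARD('n) * (\<integral>\<^sup>+z. g (sgn z) * indicator B z \<partial>lborel)"
    by (subst nn_integral_sphere_measure) (auto intro: measurable_sphere_measureI simp: B_def)
  also have "(\<integral>\<^sup>+z. g (sgn z) * indicator B z \<partial>lborel) =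
      (\<integral>\<^sup>+z. g (sgn z) * indicator B z \<partial>distr lborel borel enumerate_vec)"
    by (simp add: lborel_enumerate_vec)
  also have "\<dots> = (\<integral>\<^sup>+z. g (sgn (enumerate_vec z)) * indicator B (enumerate_vec z) \<partial>lborel)"
    by (rule nn_integral_distr) measurable
  also have "\<dots> = (\<integral>\<^sup>+z. g (enumerate_vec (sgn z)) * indicator (ball 0 1 - {0}) z \<partial>lborel)"
  proof (rule nn_integral_cong)
    fix z :: "real^'n"
    have "enumerate_vec z = 0 \<longleftrightarrow> z = 0"
      by (metis norm_enumerate_vec norm_eq_zero)
    then show "g (sgn (enumerate_vec z)) * indicator B (enumerate_vec z) =
        g (enumerate_vec (sgn z)) * indicator (ball 0 1 - {0}) z"
      by (auto simp: B_def indicator_def sgn_div_norm linear_scale[OF linear_enumerate_vec(1)])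
  qed
  also have "CARD('n) * \<dots> = (\<integral>\<^sup>+u. g (enumerate_vec u) \<partial>sphere_measure)"
    by (subst nn_integral_sphere_measure) (auto intro!: measurable_sphere_measureI)
  finally show ?thesis .
qed

lemma reflect_along_enumerate_vec:
  "reflect_along (enumerate_vec z) (enumerate_vec k) = enumerate_vec (reflect_along z k)"
  by (simp add: reflect_along_def linear_diff[OF linear_enumerate_vec(1)] linear_scale[OF linear_enumerate_vec(1)])

text \<open>Conjugation by the relabelling transfers the statement, since norms, inner products and mirror
  images are preserved.\<close>

lemma emeasure_sphere_reflection_half:
  fixes N :: "real^'n \<Rightarrow> real^'n"
  assumes n: "CARD('n) \<ge> 2" and N: "linear N"
    and norm_N: "\<And>x. (norm (N x))\<^sup>2 = (norm x)\<^sup>2 - (b \<bullet> x)\<^sup>2" and b: "norm b < 1"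
    and k: "norm k = 1" and A: "A \<in> sets sphere_measure"
  shows "emeasure sphere_measure A =
    (\<integral>\<^sup>+u. ennreal (2 * sqrt (1 - (norm b)\<^sup>2) * \<bar>2 * (k \<bullet> N u)\<bar> ^ (CARD('n) - 2) / (norm (N u)) ^ (2 * CARD('n) - 2))
       * indicator {0<..} (k \<bullet> N u) * indicator A (reflect_along (N u) k) \<partial>sphere_measure)"
proof -
  define N' where "N' = enumerate_vec \<circ> N \<circ> unenumerate_vec"
  define A' where "A' = unenumerate_vec -` A"
  have N': "linear N'" "N' (enumerate_vec x) = enumerate_vec (N x)" for x
    using N by (auto simp: N'_def intro!: linear_compose linear_enumerate_vec)
  have [measurable]: "N \<in> borel_measurable borel" "N' \<in> borel_measurable borel"
    using N N' by (auto intro: linear_borel_measurable)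
  have A_borel [measurable]: "A \<in> sets borel" and A_sph: "A \<subseteq> sphere 0 1"
    using A by (auto simp: sets_sphere_measure sets_restrict_space_iff)
  have A'_borel [measurable]: "A' \<in> sets borel"
    using measurable_sets[OF borel_enumerate_vec(2) A_borel] by (simp add: A'_def)
  have "A' \<subseteq> sphere 0 1"
    using A_sph by (auto simp: A'_def dest: subsetD)
  then have A': "A' \<in> sets sphere_measure"
    by (simp add: sets_sphere_measure sets_restrict_space_iff)
  have norm_N': "(norm (N' x))\<^sup>2 = (norm x)\<^sup>2 - (enumerate_vec b \<bullet> x)\<^sup>2" for x
    using norm_N[of "unenumerate_vec x"] inner_enumerate_vec[of b "unenumerate_vec x"]
    by (simp add: N'_def)
  have refl [measurable]: "(\<lambda>x. reflect_along (N' x) (enumerate_vec k)) \<in> borel_measurable borel"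
    by (rule measurable_compose[OF _ borel_measurable_reflect_along]) measurable
  have "emeasure sphere_measure A = (\<integral>\<^sup>+u. indicator A u \<partial>sphere_measure)"
    using A by simp
  also have "\<dots> = (\<integral>\<^sup>+u. indicator A' (enumerate_vec u) \<partial>sphere_measure)"
    by (simp add: A'_def indicator_def)
  also have "\<dots> = emeasure sphere_measure A'"
    using A' by (subst nn_integral_sphere_enumerate_vec[symmetric]) auto
  also have "\<dots> =
    (\<integral>\<^sup>+u. ennreal (2 * sqrt (1 - (norm (enumerate_vec b))\<^sup>2) * \<bar>2 * (enumerate_vec k \<bullet> N' u)\<bar> ^ (CARD('n enumerated) - 2) / (norm (N' u)) ^ (2 * CARD('n enumerated) - 2))
       * indicator {0<..} (enumerate_vec k \<bullet> N' u) * indicator A' (reflect_along (N' u) (enumerate_vec k)) \<partial>sphere_measure)"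
    using n b k A' by (intro emeasure_sphere_reflection_half_enumerated N' norm_N') auto
  also have "\<dots> =
    (\<integral>\<^sup>+u. ennreal (2 * sqrt (1 - (norm b)\<^sup>2) * \<bar>2 * (k \<bullet> N u)\<bar> ^ (CARD('n) - 2) / (norm (N u)) ^ (2 * CARD('n) - 2))
       * indicator {0<..} (k \<bullet> N u) * indicator A (reflect_along (N u) k) \<partial>sphere_measure)"
    by (subst nn_integral_sphere_enumerate_vec, measurable)
      (simp add: N'(2) reflect_along_enumerate_vec, simp add: A'_def indicator_def)
  finally show ?thesis .
qed

lemma reflect_along_sphere_measurable:
  assumes "norm k = 1" and [measurable]: "N \<in> borel_measurable borel"
  shows "(\<lambda>u. reflect_along (N u) k) \<in> sphere_measure \<rightarrow>\<^sub>M sphere_measure"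
proof -
  have "(\<lambda>u. reflect_along (N u) k) \<in> borel_measurable borel"
    by (rule measurable_compose[OF _ borel_measurable_reflect_along]) measurable
  then have "(\<lambda>u. reflect_along (N u) k) \<in> sphere_measure \<rightarrow>\<^sub>M restrict_space borel (sphere 0 1)"
    using assms(1) by (intro measurable_restrict_space2 measurable_sphere_measureI) (auto simp: norm_reflect_along)
  then show ?thesis
    by (simp cong: measurable_cong_sets add: sets_sphere_measure)
qed

text \<open>The mirror image depends only on the line through \<open>N u\<close>, so \<open>N\<close> and \<open>- N\<close> give two
  formulas for the same measure, one for each of the half-spaces \<open>k \<bullet> N u > 0\<close> and \<open>k \<bullet> N u < 0\<close>.
  Their mean has half the density on both. Where \<open>k \<bullet> N u = 0\<close> the mirror image of \<open>k\<close> is \<open>k\<close>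
  itself; the density is \<open>0\<close> there, also in dimension two, where the power
  \<open>\<bar>2 * (k \<bullet> N u)\<bar> ^ 0\<close> would be \<open>1\<close>.\<close>

lemma sphere_measure_eq_distr_reflection:
  fixes N :: "real^'n \<Rightarrow> real^'n"
  assumes n: "CARD('n) \<ge> 2" and N: "linear N"
    and norm_N: "\<And>x. (norm (N x))\<^sup>2 = (norm x)\<^sup>2 - (b \<bullet> x)\<^sup>2" and b: "norm b < 1"
    and k: "norm k = 1"
  shows "sphere_measure = distr (density sphere_measure
      (\<lambda>u. ennreal (if k \<bullet> N u = 0 then 0 else
         sqrt (1 - (norm b)\<^sup>2) * \<bar>2 * (k \<bullet> N u)\<bar> ^ (CARD('n) - 2) / (norm (N u)) ^ (2 * CARD('n) - 2))))
    sphere_measure (\<lambda>u. reflect_along (N u) k)" (is "_ = distr (density _ ?W) _ ?T")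
proof (rule measure_eqI)
  fix A :: "(real^'n) set" assume A: "A \<in> sets sphere_measure"
  have [measurable]: "N \<in> borel_measurable borel"
    using N by (rule linear_borel_measurable)
  have A_borel [measurable]: "A \<in> sets borel"
    using A by (auto simp: sets_sphere_measure sets_restrict_space_iff)
  have T_borel [measurable]: "?T \<in> borel_measurable borel"
    by (rule measurable_compose[OF _ borel_measurable_reflect_along]) measurable
  have T: "?T \<in> sphere_measure \<rightarrow>\<^sub>M sphere_measure"
    using k by (rule reflect_along_sphere_measurable) measurable
  have W: "?W \<in> borel_measurable sphere_measure"
    by (rule measurable_sphere_measureI) measurable
  define w where "w u = ennreal (2 * sqrt (1 - (norm b)\<^sup>2) * \<bar>2 * (k \<bullet> N u)\<bar> ^ (CARD('n) - 2) / (norm (N u)) ^ (2 * CARD('n) - 2))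
    * indicator A (?T u)" for u
  have w_borel [measurable]: "w \<in> borel_measurable borel"
    unfolding w_def by measurable
  have minus: "reflect_along (- z) k = reflect_along z k" for z
    by (simp add: reflect_along_def)
  have pos: "emeasure sphere_measure A = (\<integral>\<^sup>+u. w u * indicator {0<..} (k \<bullet> N u) \<partial>sphere_measure)"
    unfolding emeasure_sphere_reflection_half[OF assms A] w_def by (simp add: mult_ac)
  have neg: "emeasure sphere_measure A = (\<integral>\<^sup>+u. w u * indicator {..<0} (k \<bullet> N u) \<partial>sphere_measure)"
    using emeasure_sphere_reflection_half[of "\<lambda>x. - N x" b k A] n N norm_N b k A
    unfolding w_def minus by (simp add: linear_compose_neg mult_ac indicator_def)
  have "2 * emeasure sphere_measure A = (\<integral>\<^sup>+u. w u * indicator {0<..} (k \<bullet> N u) \<partial>sphere_measure)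
      + (\<integral>\<^sup>+u. w u * indicator {..<0} (k \<bullet> N u) \<partial>sphere_measure)"
    using pos neg by (metis mult_2)
  also have "\<dots> = (\<integral>\<^sup>+u. w u * indicator {0<..} (k \<bullet> N u) + w u * indicator {..<0} (k \<bullet> N u) \<partial>sphere_measure)"
    by (rule nn_integral_add[symmetric]; rule measurable_sphere_measureI; measurable)
  also have "\<dots> = (\<integral>\<^sup>+u. 2 * (?W u * indicator A (?T u)) \<partial>sphere_measure)"
  proof (rule nn_integral_cong)
    fix u :: "real^'n"
    have "ennreal (2 * s * a / d) = 2 * ennreal (s * a / d)" for s a d :: real
      using ennreal_mult'[of 2 "s * a / d"] by (simp add: mult.assoc)
    then show "w u * indicator {0<..} (k \<bullet> N u) + w u * indicator {..<0} (k \<bullet> N u) = 2 * (?W u * indicator A (?T u))"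
      by (auto simp: w_def indicator_def mult.assoc)
  qed
  also have "\<dots> = 2 * (\<integral>\<^sup>+u. ?W u * indicator A (?T u) \<partial>sphere_measure)"
    by (rule nn_integral_cmult, rule measurable_sphere_measureI) measurable
  finally have "emeasure sphere_measure A = (\<integral>\<^sup>+u. ?W u * indicator A (?T u) \<partial>sphere_measure)"
    by (simp add: ennreal_mult_cancel_left)
  also have "\<dots> = emeasure (distr (density sphere_measure ?W) sphere_measure ?T) A"
  proof -
    have "emeasure (distr (density sphere_measure ?W) sphere_measure ?T) A =
        emeasure (density sphere_measure ?W) (?T -` A \<inter> space sphere_measure)"
      using T A by (subst emeasure_distr) auto
    also have "\<dots> = (\<integral>\<^sup>+u. ?W u * indicator (?T -` A \<inter> space sphere_measure) u \<partial>sphere_measure)"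
      using W measurable_sets[OF T A] by (rule emeasure_density)
    also have "\<dots> = (\<integral>\<^sup>+u. ?W u * indicator A (?T u) \<partial>sphere_measure)"
      by (rule nn_integral_cong) (simp add: indicator_def)
    finally show ?thesis ..
  qed
  finally show "emeasure sphere_measure A = emeasure (distr (density sphere_measure ?W) sphere_measure ?T) A" .
qed simp

section \<open>Minkowski space and Lorentz transformations\<close>

definition spatial :: "'n::finite spacetime \<Rightarrow> real ^ 'n" where
  "spatial X = (\<chi> i. X $ Some i)"

lemma spacetime_vec_nth [simp]:
  "spacetime_vec t x $ None = t" "spacetime_vec t x $ Some i = x $ i"
  by (simp_all add: spacetime_vec_def)

lemma spatial_spacetime_vec [simp]: "spatial (spacetime_vec t x) = x"
  by (simp add: spatial_def)

lemma spacetime_vec_eqI: "X $ None = Y $ None \<Longrightarrow> spatial X = spatial Y \<Longrightarrow> X = Y"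
  by (simp add: vec_eq_iff spatial_def) (metis option.exhaust)

lemma linear_spatial: "linear spatial"
  by (simp add: linear_iff spatial_def vec_eq_iff)

lemma spacetime_vec_arith:
  "spacetime_vec t x + spacetime_vec u y = spacetime_vec (t + u) (x + y)"
  "spacetime_vec t x - spacetime_vec u y = spacetime_vec (t - u) (x - y)"
  "a *\<^sub>R spacetime_vec t x = spacetime_vec (a * t) (a *\<^sub>R x)"
  by (rule spacetime_vec_eqI; simp add: spatial_def vec_eq_iff)+

lemma sum_UNIV_option:
  fixes f :: "'n::finite option \<Rightarrow> 'a::comm_monoid_add"
  shows "(\<Sum>\<mu>\<in>UNIV. f \<mu>) = f None + (\<Sum>i\<in>UNIV. f (Some i))"
  by (simp add: UNIV_option_conv sum.reindex)

lemma minkowski_mult_vec: "minkowski *v X = spacetime_vec (- X $ None) (spatial X)"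
proof (rule spacetime_vec_eqI)
  have "(minkowski *v X) $ \<mu> = (case \<mu> of None \<Rightarrow> - 1 | Some i \<Rightarrow> 1) * X $ \<mu>" for \<mu>
    by (simp add: matrix_vector_mult_def minkowski_def if_distrib[of "\<lambda>a. a * _"] cong: if_cong)
  then show "(minkowski *v X) $ None = spacetime_vec (- X $ None) (spatial X) $ None"
    "spatial (minkowski *v X) = spatial (spacetime_vec (- X $ None) (spatial X))"
    by (simp_all add: spatial_def)
qed

lemma matrix_inv_minkowski: "matrix_inv minkowski = minkowski"
proof -
  have "minkowski ** minkowski = mat 1"
    by (simp add: matrix_eq matrix_vector_mul_assoc[symmetric] minkowski_mult_vec)
      (simp add: spacetime_vec_eqI)
  then show ?thesis
    unfolding matrix_inv_def
    by (intro some_equality) (auto, metis matrix_mul_assoc matrix_mul_lid matrix_mul_rid)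
qed

definition minkowski_prod :: "'n::finite spacetime \<Rightarrow> 'n spacetime \<Rightarrow> real" where
  "minkowski_prod X Y = spatial X \<bullet> spatial Y - X $ None * Y $ None"

lemma minkowski_prod_eq: "minkowski_prod X Y = X \<bullet> (minkowski *v Y)"
  by (simp add: minkowski_prod_def minkowski_mult_vec inner_vec_def sum_UNIV_option spatial_def)

text \<open>The matrix form of the Lorentz condition: up to the metric, the transpose of \<open>\<Lambda>\<close> is its inverse.\<close>

lemma lorentz_transpose:
  assumes "lorentz \<Lambda>"
  shows "transpose \<Lambda> *v (minkowski *v (\<Lambda> *v X)) = minkowski *v X"
proof -
  have "transpose \<Lambda> ** (minkowski ** \<Lambda>) = minkowski"
    using assms by (simp add: lorentz_def vec_eq_iff matrix_matrix_mult_def transpose_def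
        sum_distrib_left mult.assoc)
  then show ?thesis
    by (metis matrix_vector_mul_assoc)
qed

lemma minkowski_prod_lorentz:
  assumes "lorentz \<Lambda>"
  shows "minkowski_prod (\<Lambda> *v X) (\<Lambda> *v Y) = minkowski_prod X Y"
proof -
  have "(\<Lambda> *v X) \<bullet> (minkowski *v (\<Lambda> *v Y)) = X \<bullet> (transpose \<Lambda> *v (minkowski *v (\<Lambda> *v Y)))"
    using dot_lmul_matrix[of "minkowski *v (\<Lambda> *v Y)" \<Lambda> X]
    by (simp add: inner_commute transpose_matrix_vector)
  then show ?thesis
    by (simp only: minkowski_prod_eq lorentz_transpose[OF assms])
qed

lemma cm_L_spatial: "cm_L \<Lambda> $ Some i $ \<kappa> = - \<Lambda> $ \<kappa> $ Some i"
  unfolding cm_L_def matrix_inv_minkowski by (simp add: minkowski_def if_distrib[of "\<lambda>a. a * _"] cong: if_cong)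

text \<open>The matrix \<open>cm_L \<Lambda>\<close> is built from \<open>g\<^sup>-\<^sup>1 \<Lambda>\<^sup>T\<close>; with the signs of the metric its spatial rows compute
  the spatial part of \<open>\<Lambda>\<^sup>-\<^sup>1 (t, y)\<close>. Hence the outgoing momenta of the centre-of-momentum
  parametrization are known as soon as a four-vector is found that \<open>\<Lambda>\<close> maps to \<open>(t, y)\<close>.\<close>

lemma cm_L_inverts_lorentz:
  assumes "lorentz \<Lambda>" and X: "\<Lambda> *v X = spacetime_vec t y"
  shows "cm_L \<Lambda> $ Some i $ None * t - (\<Sum>j\<in>UNIV. cm_L \<Lambda> $ Some i $ Some j * y $ j) = spatial X $ i"
proof -
  have "spatial X $ i = (transpose \<Lambda> *v (minkowski *v spacetime_vec t y)) $ Some i"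
    using lorentz_transpose[OF assms(1), of X] by (simp add: X minkowski_mult_vec)
  also have "\<dots> = cm_L \<Lambda> $ Some i $ None * t - (\<Sum>j\<in>UNIV. cm_L \<Lambda> $ Some i $ Some j * y $ j)"
    unfolding minkowski_mult_vec by (simp add: matrix_vector_mult_def transpose_def sum_UNIV_option cm_L_spatial sum_negf)
  finally show ?thesis ..
qed

section \<open>Kinematics of the collision\<close>

lemma energy_squared: "(energy c p)\<^sup>2 = c\<^sup>2 + (norm p)\<^sup>2"
  by (simp add: energy_def)

lemma norm_less_energy: "c > 0 \<Longrightarrow> norm p < energy c p"
  unfolding energy_def by (intro real_less_rsqrt) auto

lemma energy_pos: "c > 0 \<Longrightarrow> energy c p > 0"
  using norm_less_energy[of c p] norm_ge_zero[of p] by linarith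

lemma mandelstam_s_eq: "mandelstam_s c p q = (energy c p + energy c q)\<^sup>2 - (norm (p + q))\<^sup>2"
proof -
  have "(norm (p + q))\<^sup>2 = (norm p)\<^sup>2 + (norm q)\<^sup>2 + 2 * (p \<bullet> q)"
    by (simp add: power2_norm_eq_inner inner_simps inner_commute)
  then show ?thesis
    by (simp add: mandelstam_s_def power2_sum energy_squared)
qed

lemma norm_sum_less_energy: "c > 0 \<Longrightarrow> norm (p + q) < energy c p + energy c q"
  using norm_triangle_ineq[of p q] norm_less_energy[of c p] norm_less_energy[of c q] by linarith

lemma mandelstam_s_pos: "c > 0 \<Longrightarrow> mandelstam_s c p q > 0"
  using norm_sum_less_energy[of c p q] by (simp add: mandelstam_s_eq power_strict_mono)

lemma rel_mom_radicand:
  "2 * (energy c p * energy c q - p \<bullet> q - c\<^sup>2) = (norm (p - q))\<^sup>2 - (energy c p - energy c q)\<^sup>2"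
proof -
  have "(norm (p - q))\<^sup>2 = (norm p)\<^sup>2 + (norm q)\<^sup>2 - 2 * (p \<bullet> q)"
    by (simp add: power2_norm_eq_inner inner_simps inner_commute)
  then show ?thesis
    by (simp add: power2_diff energy_squared)
qed

text \<open>The strict Cauchy-Schwarz inequality \<open>c\<^sup>2 + p \<bullet> q < p\<^sup>0 q\<^sup>0\<close> for the vectors \<open>(c, p)\<close> and \<open>(c, q)\<close>,
  which are not parallel; the term \<open>c\<^sup>2 |p - q|\<^sup>2\<close> makes it strict.\<close>

lemma rel_mom_pos:
  assumes "c > 0" "p \<noteq> q"
  shows "rel_mom c p q > 0"
proof -
  have "(c\<^sup>2 + p \<bullet> q)\<^sup>2 < (energy c p * energy c q)\<^sup>2"
  proof -
    have "(p \<bullet> q)\<^sup>2 \<le> (norm p)\<^sup>2 * (norm q)\<^sup>2"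
      using Cauchy_Schwarz_ineq[of p q] by (simp add: power2_norm_eq_inner)
    moreover have "c\<^sup>2 * (norm (p - q))\<^sup>2 > 0"
      using assms by simp
    moreover have "(norm (p - q))\<^sup>2 = (norm p)\<^sup>2 + (norm q)\<^sup>2 - 2 * (p \<bullet> q)"
      by (simp add: power2_norm_eq_inner inner_simps inner_commute)
    ultimately show ?thesis
      by (simp add: power_mult_distrib energy_squared power2_sum algebra_simps)
  qed
  then have "c\<^sup>2 + p \<bullet> q < energy c p * energy c q"
    by (rule power_less_imp_less_base) (use energy_pos[OF assms(1), of p] energy_pos[OF assms(1), of q] in simp)
  then show ?thesis
    by (simp add: rel_mom_def)
qed

locale collision =
  fixes c :: real and p q :: "real ^ 'n" and \<Lambda> :: "'n::finite spacetime_matrix"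
  assumes c: "c > 0" and pq: "p \<noteq> q" and lorentz: "lorentz \<Lambda>"
    and cm_frame: "\<Lambda> *v (four_mom c p + four_mom c q) = spacetime_vec (sqrt (mandelstam_s c p q)) 0"
begin

definition "E = energy c p + energy c q"
abbreviation "s \<equiv> mandelstam_s c p q"
abbreviation "\<rho> \<equiv> rel_mom c p q"
text \<open>The velocity, in units of the speed of light, of the centre-of-momentum frame.\<close>

definition "b = (1 / E) *\<^sub>R (p + q)"
text \<open>The four-vector with spatial part \<open>x\<close> that is orthogonal to the total momentum. Its image
  under \<open>\<Lambda>\<close> is therefore purely spatial, and this image defines \<open>N\<close>.\<close>

definition "lift x = spacetime_vec (b \<bullet> x) x"
definition "N x = spatial (\<Lambda> *v lift x)"
definition "k = cm_k c \<Lambda> p q"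
definition "w = energy c p *\<^sub>R q - energy c q *\<^sub>R p"

lemma positive: "energy c p > 0" "energy c q > 0" "E > 0" "s > 0" "\<rho> > 0"
  using energy_pos[OF c, of p] energy_pos[OF c, of q] mandelstam_s_pos[OF c, of p q] rel_mom_pos[OF c pq]
  by (simp_all add: E_def)

lemma norm_b: "norm b < 1"
  using norm_sum_less_energy[OF c, of p q] positive(3) by (simp add: b_def E_def)

lemma sqrt_defect_b: "sqrt (1 - (norm b)\<^sup>2) = sqrt s / E"
proof -
  have "norm b = norm (p + q) / E"
    using positive(3) by (simp add: b_def)
  then have "1 - (norm b)\<^sup>2 = s / E\<^sup>2"
    using positive(3) by (simp add: mandelstam_s_eq E_def[symmetric] power_divide diff_divide_distrib)
  then show ?thesis
    using positive(3) by (simp add: real_sqrt_divide)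
qed

lemma total_momentum: "four_mom c p + four_mom c q = spacetime_vec E (p + q)"
  by (simp add: four_mom_def spacetime_vec_arith E_def)

lemma momentum_difference: "four_mom c p - four_mom c q = spacetime_vec (energy c p - energy c q) (p - q)"
  by (simp add: four_mom_def spacetime_vec_arith)

text \<open>In the centre-of-momentum frame the total momentum points in the time direction, so the energy of
  a four-vector there is an invariant product with the total momentum.\<close>

lemma time_component_cm:
  "(\<Lambda> *v X) $ None = - minkowski_prod X (spacetime_vec E (p + q)) / sqrt s"
proof -
  have "minkowski_prod (\<Lambda> *v X) (spacetime_vec (sqrt s) 0) = minkowski_prod X (spacetime_vec E (p + q))"
    using minkowski_prod_lorentz[OF lorentz, of X "four_mom c p + four_mom c q"] cm_frame total_momentum by simp
  then show ?thesis
    using positive(4) by (simp add: minkowski_prod_def field_simps)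
qed

lemma lorentz_lift: "\<Lambda> *v lift x = spacetime_vec 0 (N x)"
proof (rule spacetime_vec_eqI)
  have "minkowski_prod (lift x) (spacetime_vec E (p + q)) = 0"
    using positive(3) by (simp add: minkowski_prod_def lift_def b_def inner_commute)
  then show "(\<Lambda> *v lift x) $ None = spacetime_vec 0 (N x) $ None"
    by (simp add: time_component_cm)
qed (simp add: N_def)

lemma cm_k_eq: "k = spatial (\<Lambda> *v (four_mom c p - four_mom c q))"
  by (simp add: k_def cm_k_def spatial_def matrix_vector_mult_def)

text \<open>In the centre-of-momentum frame the energies of the two particles agree, because both have the
  same rest mass.\<close>

lemma lorentz_momentum_difference: "\<Lambda> *v (four_mom c p - four_mom c q) = spacetime_vec 0 k"
proof (rule spacetime_vec_eqI)
  have "minkowski_prod (four_mom c p - four_mom c q) (spacetime_vec E (p + q)) = 0"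
    unfolding momentum_difference minkowski_prod_def E_def
    by (simp add: inner_simps inner_commute algebra_simps flip: power2_norm_eq_inner power2_eq_square)
      (simp add: energy_squared)
  then show "(\<Lambda> *v (four_mom c p - four_mom c q)) $ None = spacetime_vec 0 k $ None"
    by (simp add: time_component_cm)
qed (simp add: cm_k_eq)

lemma linear_lift: "linear lift"
  by (auto simp: linear_iff lift_def spacetime_vec_arith inner_add_right)

lemma linear_N: "linear N"
  using linear_compose[OF linear_compose[OF linear_lift matrix_vector_mul_linear] linear_spatial, of \<Lambda>]
  by (simp add: N_def[abs_def] comp_def)

lemma norm_N: "(norm (N x))\<^sup>2 = (norm x)\<^sup>2 - (b \<bullet> x)\<^sup>2"
proof -
  have "minkowski_prod (spacetime_vec 0 (N x)) (spacetime_vec 0 (N x)) = minkowski_prod (lift x) (lift x)"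
    by (simp only: lorentz_lift[symmetric] minkowski_prod_lorentz[OF lorentz])
  then show ?thesis
    unfolding power2_norm_eq_inner by (simp add: minkowski_prod_def lift_def power2_eq_square)
qed

lemma norm_k: "norm k = \<rho>"
proof -
  have "minkowski_prod (spacetime_vec 0 k) (spacetime_vec 0 k) =
      minkowski_prod (four_mom c p - four_mom c q) (four_mom c p - four_mom c q)"
    by (simp only: lorentz_momentum_difference[symmetric] minkowski_prod_lorentz[OF lorentz])
  then have "(norm k)\<^sup>2 = (norm (p - q))\<^sup>2 - (energy c p - energy c q)\<^sup>2"
    unfolding power2_norm_eq_inner by (simp add: minkowski_prod_def momentum_difference power2_eq_square)
  then have "(norm k)\<^sup>2 = 2 * (energy c p * energy c q - p \<bullet> q - c\<^sup>2)"
    by (simp only: rel_mom_radicand)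
  then show ?thesis
    by (metis norm_ge_zero real_sqrt_unique rel_mom_def)
qed

text \<open>An inner product of two purely spatial vectors is an invariant Minkowski product, evaluated in
  the laboratory frame.\<close>

lemma inner_k_N: "k \<bullet> N x = - 2 * (x \<bullet> w) / E"
proof -
  have "minkowski_prod (spacetime_vec 0 k) (spacetime_vec 0 (N x)) =
      minkowski_prod (four_mom c p - four_mom c q) (lift x)"
    by (simp only: lorentz_momentum_difference[symmetric] lorentz_lift[symmetric] minkowski_prod_lorentz[OF lorentz])
  then have "k \<bullet> N x = (p - q) \<bullet> x - (energy c p - energy c q) * (b \<bullet> x)"
    by (simp add: minkowski_prod_def momentum_difference lift_def)
  also have "\<dots> * E = (p - q) \<bullet> x * E - (energy c p - energy c q) * ((b \<bullet> x) * E)"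
    by (simp add: algebra_simps)
  also have "(b \<bullet> x) * E = (p + q) \<bullet> x"
    using positive(3) by (simp add: b_def)
  also have "(p - q) \<bullet> x * E - (energy c p - energy c q) * ((p + q) \<bullet> x) = - 2 * (x \<bullet> w)"
    by (simp add: E_def w_def inner_simps inner_commute algebra_simps)
  finally show ?thesis
    using positive(3) by (simp add: field_simps)
qed

lemma gs_denom_eq:
  assumes "norm \<omega> = 1"
  shows "gs_denom c p q \<omega> = E\<^sup>2 * (norm (N \<omega>))\<^sup>2"
proof -
  have "b \<bullet> \<omega> = \<omega> \<bullet> (p + q) / E"
    by (simp add: b_def inner_commute)
  then show ?thesis
    using positive(3) assms by (simp add: norm_N gs_denom_def E_def[symmetric] power_divide right_diff_distrib)
qed

lemma norm_N_pos: "norm \<omega> = 1 \<Longrightarrow> norm (N \<omega>) > 0"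
  using norm_defect_nonzero[of N \<omega> b, OF norm_N norm_b] by (cases "\<omega> = 0") auto

text \<open>By \<open>inner_k_N\<close> and \<open>gs_denom_eq\<close>, \<open>a\<close> is the coefficient of a reflection along \<open>N \<omega>\<close>:
  the relative momentum \<open>k\<close> is changed by \<open>2 a N \<omega>\<close>.\<close>

lemma gs_a_eq:
  assumes "norm \<omega> = 1"
  shows "gs_a c p q \<omega> = - (k \<bullet> N \<omega>) / (norm (N \<omega>))\<^sup>2"
  using positive(3) norm_N_pos[OF assms] unfolding gs_a_def gs_denom_eq[OF assms] inner_k_N
  by (simp add: E_def[symmetric] w_def[symmetric] power2_eq_square field_simps)

text \<open>The unit vector of the centre-of-momentum frame that corresponds to the laboratory vector \<open>\<omega>\<close>.\<close>

definition "T \<omega> = reflect_along (N \<omega>) (k /\<^sub>R \<rho>)"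

lemma T_eq:
  assumes "norm \<omega> = 1"
  shows "\<rho> *\<^sub>R T \<omega> = k + (2 * gs_a c p q \<omega>) *\<^sub>R N \<omega>"
  using positive(5) by (simp add: T_def reflect_along_def gs_a_eq[OF assms] scaleR_diff_right)

text \<open>Each momentum is half the total momentum plus or minus half the relative momentum. The
  transformation \<open>\<Lambda>\<close> maps these to \<open>(\<surd>s, 0)\<close> and \<open>(0, k)\<close>, and the exchange \<open>a lift \<omega>\<close> turns \<open>k\<close> into
  \<open>\<rho> T \<omega>\<close>.\<close>

lemma lorentz_outgoing:
  assumes "norm \<omega> = 1"
  shows "\<Lambda> *v (four_mom c p + gs_a c p q \<omega> *\<^sub>R lift \<omega>) = spacetime_vec (sqrt s / 2) ((\<rho> / 2) *\<^sub>R T \<omega>)"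
    and "\<Lambda> *v (four_mom c q - gs_a c p q \<omega> *\<^sub>R lift \<omega>) = spacetime_vec (sqrt s / 2) (- (\<rho> / 2) *\<^sub>R T \<omega>)"
proof -
  let ?P = "four_mom c p" and ?Q = "four_mom c q"
  have half: "(\<rho> / 2) *\<^sub>R T \<omega> = (1 / 2) *\<^sub>R k + gs_a c p q \<omega> *\<^sub>R N \<omega>"
    using arg_cong[OF T_eq[OF assms], of "(*\<^sub>R) (1 / 2)"] by (simp add: scaleR_add_right)
  have P: "?P = (1 / 2) *\<^sub>R (?P + ?Q) + (1 / 2) *\<^sub>R (?P - ?Q)"
    and Q: "?Q = (1 / 2) *\<^sub>R (?P + ?Q) - (1 / 2) *\<^sub>R (?P - ?Q)"
    by (simp_all add: vec_eq_iff field_simps)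
  have "\<Lambda> *v (?P + gs_a c p q \<omega> *\<^sub>R lift \<omega>) =
      (1 / 2) *\<^sub>R (\<Lambda> *v (?P + ?Q)) + (1 / 2) *\<^sub>R (\<Lambda> *v (?P - ?Q)) + gs_a c p q \<omega> *\<^sub>R (\<Lambda> *v lift \<omega>)"
    by (subst P) (simp only: matrix_vector_right_distrib matrix_vector_mult_scaleR)
  then show "\<Lambda> *v (?P + gs_a c p q \<omega> *\<^sub>R lift \<omega>) = spacetime_vec (sqrt s / 2) ((\<rho> / 2) *\<^sub>R T \<omega>)"
    by (simp add: cm_frame lorentz_momentum_difference lorentz_lift spacetime_vec_arith half)
  have "\<Lambda> *v (?Q - gs_a c p q \<omega> *\<^sub>R lift \<omega>) =
      (1 / 2) *\<^sub>R (\<Lambda> *v (?P + ?Q)) - (1 / 2) *\<^sub>R (\<Lambda> *v (?P - ?Q)) - gs_a c p q \<omega> *\<^sub>R (\<Lambda> *v lift \<omega>)"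
    by (subst Q) (simp only: matrix_vector_right_distrib matrix_vector_mult_diff_distrib matrix_vector_mult_scaleR)
  then show "\<Lambda> *v (?Q - gs_a c p q \<omega> *\<^sub>R lift \<omega>) = spacetime_vec (sqrt s / 2) (- (\<rho> / 2) *\<^sub>R T \<omega>)"
    by (simp add: cm_frame lorentz_momentum_difference lorentz_lift spacetime_vec_arith half)
qed

lemma cm_p'_T: "norm \<omega> = 1 \<Longrightarrow> cm_p' c \<Lambda> p q (T \<omega>) = gs_p' c p q \<omega>"
  using cm_L_inverts_lorentz[OF lorentz lorentz_outgoing(1)]
  by (simp add: vec_eq_iff cm_p'_def gs_p'_def lift_def spatial_def four_mom_def sum_distrib_left mult_ac)

lemma cm_q'_T: "norm \<omega> = 1 \<Longrightarrow> cm_q' c \<Lambda> p q (T \<omega>) = gs_q' c p q \<omega>"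
  using cm_L_inverts_lorentz[OF lorentz lorentz_outgoing(2)]
  by (simp add: vec_eq_iff cm_q'_def gs_q'_def lift_def spatial_def four_mom_def sum_distrib_left sum_negf mult_ac)

lemma cm_theta_T:
  assumes "norm \<omega> = 1"
  shows "cm_theta c \<Lambda> p q (T \<omega>) = gs_theta c p q \<omega>"
proof -
  have kk: "k \<bullet> k = \<rho>\<^sup>2" by (simp add: norm_k flip: power2_norm_eq_inner)
  have "(k /\<^sub>R \<rho>) \<bullet> T \<omega> = 1 - 2 * (k \<bullet> N \<omega>)\<^sup>2 / (\<rho>\<^sup>2 * (norm (N \<omega>))\<^sup>2)"
    using positive(5) by (simp add: T_def reflect_along_def inner_diff_right kk power2_eq_square field_simps)
  also have "\<dots> = 1 - 8 / \<rho>\<^sup>2 * ((\<omega> \<bullet> w)\<^sup>2 / gs_denom c p q \<omega>)"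
    using positive(3) by (simp add: inner_k_N gs_denom_eq[OF assms] power_divide power_mult_distrib)
  finally show ?thesis
    by (simp add: cm_theta_def gs_theta_def k_def[symmetric] norm_k w_def)
qed

text \<open>Both sides vanish for \<open>\<omega> \<bullet> w = 0\<close>: the left one by its case distinction, the right one by the factor
  \<open>B\<close>. Elsewhere \<open>A\<close> is positive and equals \<open>\<bar>2 (k / \<rho>) \<bullet> N \<omega>\<bar> / |N \<omega>|\<^sup>2\<close>, so the power
  \<open>n - 2\<close> in the Jacobian is \<open>A\<^sup>n\<^sup>-\<^sup>2\<close> up to powers of \<open>|N \<omega>|\<close>. The factor \<open>|\<omega> \<bullet> w|\<close> of \<open>B\<close> supplies
  the missing factor \<open>A\<close> in \<open>B A\<^sup>n\<^sup>-\<^sup>3\<close>.\<close>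

lemma weight_eq:
  assumes n: "CARD('n) \<ge> 2" and \<omega>: "norm \<omega> = 1"
  shows "(if (k /\<^sub>R \<rho>) \<bullet> N \<omega> = 0 then 0 else sqrt (1 - (norm b)\<^sup>2) * \<bar>2 * ((k /\<^sub>R \<rho>) \<bullet> N \<omega>)\<bar> ^ (CARD('n) - 2)
      / norm (N \<omega>) ^ (2 * CARD('n) - 2)) * moller_velocity c p q =
    s / (energy c p * energy c q) * gs_Bn c p q \<omega>"
proof -
  define a where "a = \<bar>\<omega> \<bullet> w\<bar>"
  define z where "z = norm (N \<omega>)"
  have z: "z > 0" using norm_N_pos[OF \<omega>] by (simp add: z_def)
  have "energy c p * energy c q * (\<omega> \<bullet> (p /\<^sub>R energy c p - q /\<^sub>R energy c q)) = - (\<omega> \<bullet> w)"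
    using positive by (simp add: w_def inner_diff_right field_simps)
  from arg_cong[OF this, of abs] have a: "energy c p * energy c q * \<bar>\<omega> \<bullet> (p /\<^sub>R energy c p - q /\<^sub>R energy c q)\<bar> = a"
    using positive by (simp add: a_def abs_mult)
  have B: "gs_B c p q \<omega> = c * a / (E\<^sup>2 * z ^ 4)"
    using positive(3) z unfolding gs_B_def gs_denom_eq[OF \<omega>] E_def[symmetric] a[symmetric] z_def[symmetric]
    by (simp add: field_simps power2_eq_square power4_eq_xxxx)
  have A: "gs_A c p q \<omega> = 4 * a / (E * z\<^sup>2 * \<rho>)"
    using positive(3) z unfolding gs_A_def gs_denom_eq[OF \<omega>] E_def[symmetric] a[symmetric] z_def[symmetric]
    by (simp add: field_simps power2_eq_square)
  have kN: "\<bar>2 * ((k /\<^sub>R \<rho>) \<bullet> N \<omega>)\<bar> = 4 * a / (E * \<rho>)"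
    using positive by (simp add: inner_k_N a_def abs_mult divide_inverse mult_ac)
  show ?thesis
  proof (cases "a = 0")
    case True
    then show ?thesis using kN by (simp add: gs_Bn_def B)
  next
    case False
    then have a_pos: "a > 0" by (simp add: a_def)
    define A' where "A' = 4 * a / (E * z\<^sup>2 * \<rho>)"
    have A'_pos: "A' > 0" using a_pos z positive by (simp add: A'_def)
    obtain m where m: "CARD('n) = m + 2" using n by (metis le_add_diff_inverse2)
    have pw: "A' powi (int CARD('n) - 3) = A' ^ m / A'"
      using A'_pos by (simp add: m power_int_diff power_int_add)
    have nz: "(k /\<^sub>R \<rho>) \<bullet> N \<omega> \<noteq> 0"
    proof
      assume "(k /\<^sub>R \<rho>) \<bullet> N \<omega> = 0"
      then have "4 * a / (E * \<rho>) = 0" by (simp only: kN[symmetric])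
      with a_pos positive show False by simp
    qed
    have ratio: "\<bar>2 * ((k /\<^sub>R \<rho>) \<bullet> N \<omega>)\<bar> ^ (CARD('n) - 2) / z ^ (2 * CARD('n) - 2) = A' ^ m / z\<^sup>2"
    proof -
      have "4 * a / (E * \<rho>) = A' * z\<^sup>2"
        using z by (simp add: A'_def)
      moreover have "z ^ (2 * CARD('n) - 2) = (z\<^sup>2) ^ m * z\<^sup>2"
        by (simp add: m power_mult[symmetric] power_add[symmetric])
      ultimately show ?thesis
        using z unfolding kN by (simp add: m power_mult_distrib)
    qed
    have Bn: "gs_Bn c p q \<omega> = c * \<rho> / (4 * E * z\<^sup>2) * A' ^ m"
    proof -
      have a_eq: "a = A' * (E * z\<^sup>2 * \<rho>) / 4"
        using z positive by (simp add: A'_def)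
      have "gs_Bn c p q \<omega> = c * a / (E\<^sup>2 * z ^ 4) * (A' ^ m / A')"
        by (simp only: gs_Bn_def A B A'_def[symmetric] pw)
      also have "\<dots> = c * (A' * (E * z\<^sup>2 * \<rho>) / 4) / (E\<^sup>2 * z ^ 4) * (A' ^ m / A')"
        by (simp only: a_eq[symmetric])
      also have "\<dots> = c * \<rho> / (4 * E * z\<^sup>2) * A' ^ m"
        using z positive A'_pos by (simp add: field_simps power2_eq_square power4_eq_xxxx)
      finally show ?thesis .
    qed
    have "r / E * (A' ^ m / z\<^sup>2) * (c / 4 * (\<rho> * r / (energy c p * energy c q))) =
        (r * r) / (energy c p * energy c q) * (c * \<rho> / (4 * E * z\<^sup>2) * A' ^ m)" for r
      by (simp add: mult_ac)
    from this[of "sqrt s"]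
    have "sqrt s / E * (A' ^ m / z\<^sup>2) * (c / 4 * (\<rho> * sqrt s / (energy c p * energy c q))) =
        (sqrt s * sqrt s) / (energy c p * energy c q) * (c * \<rho> / (4 * E * z\<^sup>2) * A' ^ m)" .
    also have "sqrt s * sqrt s = s"
      using positive(4) by simp
    finally show ?thesis
      using nz unfolding z_def[symmetric] sqrt_defect_b moller_velocity_def Bn
      by (simp only: if_False ratio times_divide_eq_right[of "sqrt s / E", symmetric])
  qed
qed

end

section \<open>Equality of the two collision integrals\<close>

theorem corollary5:
  fixes c :: real and p q :: "real ^ 'n" and \<Lambda> :: "real ^ 'n option ^ 'n option"
    and \<sigma> :: "real \<Rightarrow> real \<Rightarrow> real"
    and G :: "(real ^ 'n) \<times> (real ^ 'n) \<times> (real ^ 'n) \<times> (real ^ 'n) \<Rightarrow> real"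
  assumes "CARD('n) \<ge> 2" and "c > 0" and "p \<noteq> q"
    and "lorentz \<Lambda>"
    and "\<Lambda> *v (four_mom c p + four_mom c q) = spacetime_vec (sqrt (mandelstam_s c p q)) 0"
    and "case_prod \<sigma> \<in> borel_measurable (restrict_space borel ({0<..} \<times> {0..pi}))"
    and "G \<in> borel_measurable borel"
    and "integrable sphere_measure (\<lambda>\<omega>. moller_velocity c p q
           * \<sigma> (rel_mom c p q) (cm_theta c \<Lambda> p q \<omega>)
           * G (p, q, cm_p' c \<Lambda> p q \<omega>, cm_q' c \<Lambda> p q \<omega>))"
    and "integrable sphere_measure (\<lambda>\<omega>. mandelstam_s c p q
           * \<sigma> (rel_mom c p q) (gs_theta c p q \<omega>) / (energy c p * energy c q)
           * gs_Bn c p q \<omega> * G (p, q, gs_p' c p q \<omega>, gs_q' c p q \<omega>))"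
  shows "(\<integral>\<omega>. moller_velocity c p q
           * \<sigma> (rel_mom c p q) (cm_theta c \<Lambda> p q \<omega>)
           * G (p, q, cm_p' c \<Lambda> p q \<omega>, cm_q' c \<Lambda> p q \<omega>) \<partial>sphere_measure)
       = (\<integral>\<omega>. mandelstam_s c p q
           * \<sigma> (rel_mom c p q) (gs_theta c p q \<omega>) / (energy c p * energy c q)
           * gs_Bn c p q \<omega> * G (p, q, gs_p' c p q \<omega>, gs_q' c p q \<omega>) \<partial>sphere_measure)"
    (is "integral\<^sup>L _ ?f = integral\<^sup>L _ ?g")
proof -
  interpret collision c p q \<Lambda>
    by unfold_locales (use assms in auto)
  have k1: "norm (k /\<^sub>R \<rho>) = 1"
    using positive(5) by (simp add: norm_k)
  let ?W = "\<lambda>\<omega>. if (k /\<^sub>R \<rho>) \<bullet> N \<omega> = 0 then 0 else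
      sqrt (1 - (norm b)\<^sup>2) * \<bar>2 * ((k /\<^sub>R \<rho>) \<bullet> N \<omega>)\<bar> ^ (CARD('n) - 2) / norm (N \<omega>) ^ (2 * CARD('n) - 2)"
  have sphere_eq: "sphere_measure = distr (density sphere_measure ?W) sphere_measure T"
    using sphere_measure_eq_distr_reflection[OF assms(1) linear_N norm_N norm_b k1]
    by (simp only: T_def[abs_def])
  have [measurable]: "N \<in> borel_measurable borel"
    using linear_N by (rule linear_borel_measurable)
  have W: "?W \<in> borel_measurable sphere_measure"
    by (rule measurable_sphere_measureI) measurable
  have W_nonneg: "?W \<omega> \<ge> 0" for \<omega>
    using norm_b by (simp add: sqrt_defect_b less_imp_le positive)
  have f: "?f \<in> borel_measurable sphere_measure"
    using assms(8) by (rule borel_measurable_integrable)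
  have T: "T \<in> sphere_measure \<rightarrow>\<^sub>M sphere_measure"
    using k1 unfolding T_def[abs_def] by (intro reflect_along_sphere_measurable) measurable
  have "integral\<^sup>L sphere_measure ?f = integral\<^sup>L (distr (density sphere_measure ?W) sphere_measure T) ?f"
    using sphere_eq by (rule arg_cong)
  also have "\<dots> = (\<integral>\<omega>. ?f (T \<omega>) \<partial>density sphere_measure ?W)"
    using T f by (intro integral_distr) auto
  also have "\<dots> = (\<integral>\<omega>. ?W \<omega> *\<^sub>R ?f (T \<omega>) \<partial>sphere_measure)"
    using W W_nonneg measurable_compose[OF T f] by (intro integral_density) auto
  also have "\<dots> = integral\<^sup>L sphere_measure ?g"
  proof (rule Bochner_Integration.integral_cong[OF refl])
    fix \<omega> :: "real^'n" assume "\<omega> \<in> space sphere_measure"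
    then have \<omega>: "norm \<omega> = 1" by simp
    have "?W \<omega> *\<^sub>R ?f (T \<omega>) = (?W \<omega> * moller_velocity c p q) *
        (\<sigma> \<rho> (gs_theta c p q \<omega>) * G (p, q, gs_p' c p q \<omega>, gs_q' c p q \<omega>))"
      by (simp only: cm_p'_T[OF \<omega>] cm_q'_T[OF \<omega>] cm_theta_T[OF \<omega>] real_scaleR_def mult.assoc)
    then show "?W \<omega> *\<^sub>R ?f (T \<omega>) = ?g \<omega>"
      unfolding weight_eq[OF assms(1) \<omega>] by simp
  qed
  finally show ?thesis .
qed
end
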